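(* Let $0\le q\in L_1^{loc}(\mathbb{R})$ and consider the equation $$-y'(x)+q(x)y(x)=f(x),\quad x\in\mathbb{R}.\qquad( * )$$ Let $p\in[1,\infty]$. Equation $( * )$ is correctly solvable in $L_p(\mathbb{R})$ if and only if there is $a\in(0,\infty)$ such that $$q_0(a):=\inf_{x\in\mathbb{R}}\int_{x-a}^{x+a}q(t)\,dt>0.$$ In particular, exactly one of the following holds: (A) for all $p\in[1,\infty]$, $( * )$ is correctly solvable in $L_p(\mathbb{R})$; (B) for all $p\in[1,\infty]$, $( * )$ is not correctly solvable in $L_p(\mathbb{R})$. In addition, when $( * )$ is correctly solvable in $L_p(\mathbb{R})$, the solution $y\in L_p(\mathbb{R})$ is given by $$y(x)=\int_{-\infty}^{\infty}G(x,t)f(t)\,dt,\qquad G(x,t)=\begin{cases}0,& t<x,\\ \exp\Big(-\int_x^t q(\xi)\,d\xi\Big),& t\ge x.\end{cases}$$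
   Context: Convention: $L_\infty(\mathbb{R})$ denotes the space $C(\mathbb{R})$ of bounded continuous functions on $\mathbb{R}$ with the sup norm. A solution of $( * )$ is any absolutely continuous function satisfying $( * )$ almost everywhere on $\mathbb{R}$. Equation $( * )$ is called correctly solvable in $L_p(\mathbb{R})$ if (I) for every $f\in L_p(\mathbb{R})$ equation $( * )$ has a unique solution $y\in L_p(\mathbb{R})$, and (II) there is a constant $c(p)\in(0,\infty)$ such that this solution satisfies $\|y\|_p\le c(p)\|f\|_p$ for all $f\in L_p(\mathbb{R})$. *)

theory Defs
  imports "HOL-Analysis.Analysis"
begin

definition abs_cont_on :: "real \<Rightarrow> real \<Rightarrow> (real \<Rightarrow> real) \<Rightarrow> bool" where
  "abs_cont_on a b y \<longleftrightarrow>
     (\<forall>\<epsilon>>0. \<exists>\<delta>>0. \<forall>(n::nat) (l::nat \<Rightarrow> real) (r::nat \<Rightarrow> real).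
        (\<forall>i<n. a \<le> l i \<and> l i \<le> r i \<and> r i \<le> b) \<longrightarrow>
        (\<forall>i<n. \<forall>j<n. i \<noteq> j \<longrightarrow> r i \<le> l j \<or> r j \<le> l i) \<longrightarrow>
        (\<Sum>i<n. r i - l i) < \<delta> \<longrightarrow>
        (\<Sum>i<n. \<bar>y (r i) - y (l i)\<bar>) < \<epsilon>)"

definition abs_cont :: "(real \<Rightarrow> real) \<Rightarrow> bool" where
  "abs_cont y \<longleftrightarrow> (\<forall>a b. a \<le> b \<longrightarrow> abs_cont_on a b y)"

text \<open>Membership in L_p(R), p in [1,infinity]; for p = infinity this is, by the paper's
  convention, the space of bounded continuous functions.\<close>
definition in_Lp :: "ennreal \<Rightarrow> (real \<Rightarrow> real) \<Rightarrow> bool" where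
  "in_Lp p f \<longleftrightarrow>
     (if p = \<infinity> then continuous_on UNIV f \<and> bounded (range f)
      else f \<in> borel_measurable lborel \<and> integrable lborel (\<lambda>x. \<bar>f x\<bar> powr enn2real p))"

definition Lp_norm :: "ennreal \<Rightarrow> (real \<Rightarrow> real) \<Rightarrow> real" where
  "Lp_norm p f =
     (if p = \<infinity> then (SUP x. \<bar>f x\<bar>)
      else (LINT x|lborel. \<bar>f x\<bar> powr enn2real p) powr (1 / enn2real p))"

definition is_solution :: "(real \<Rightarrow> real) \<Rightarrow> (real \<Rightarrow> real) \<Rightarrow> (real \<Rightarrow> real) \<Rightarrow> bool" where
  "is_solution q f y \<longleftrightarrow> abs_cont y \<and>
     (AE x in lborel. \<exists>D. (y has_real_derivative D) (at x) \<and> - D + q x * y x = f x)"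

definition correctly_solvable :: "(real \<Rightarrow> real) \<Rightarrow> ennreal \<Rightarrow> bool" where
  "correctly_solvable q p \<longleftrightarrow>
     (\<forall>f. in_Lp p f \<longrightarrow> (\<exists>!y. in_Lp p y \<and> is_solution q f y)) \<and>
     (\<exists>c>0. \<forall>f y. in_Lp p f \<longrightarrow> in_Lp p y \<longrightarrow> is_solution q f y \<longrightarrow>
                  Lp_norm p y \<le> c * Lp_norm p f)"

definition q0 :: "(real \<Rightarrow> real) \<Rightarrow> real \<Rightarrow> real" where
  "q0 q a = (INF x. (LINT t:{x-a..x+a}|lborel. q t))"

definition green :: "(real \<Rightarrow> real) \<Rightarrow> real \<Rightarrow> real \<Rightarrow> real" where
  "green q x t = (if t < x then 0 else exp (- (LINT \<xi>:{x..t}|lborel. q \<xi>)))"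

end

theory Submission
  imports Defs
begin

text \<open>Let \<open>Q\<close> be a primitive of \<open>q\<close>. By the Lebesgue differentiation theorem and the fundamental theorem of
  calculus for absolutely continuous functions, the solutions are exactly
  \<open>y = exp Q (c - H)\<close> with \<open>H\<close> a primitive of \<open>exp (- Q) f\<close>.

  If \<open>q0 q a = \<delta> > 0\<close>, then \<open>Q\<close> grows at least linearly, so \<open>\<bar>green q x t\<bar> \<le> ker (t - x)\<close> with an exponentially
  decaying \<open>ker\<close>. Young's inequality bounds the Green operator on every \<open>L_p\<close>, and no nonzero multiple of \<open>exp Q\<close>
  lies in \<open>L_p\<close>, which gives uniqueness.

  If \<open>q0 q a = 0\<close> for every \<open>a\<close>, then there are arbitrarily long intervals on which \<open>Q\<close> is almost constant. A bump
  \<open>y\<close> supported on such an interval of length \<open>2 a\<close> has \<open>f = - y' + q y\<close> smaller than \<open>y\<close> by a factor of order \<open>1 / a\<close>,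
  so no norm bound \<open>c\<close> is possible.\<close>

text \<open>The explicit solution formula reduces correct solvability to asking which functions
  \<open>exp Q (c - H)\<close> lie in \<open>L_p\<close>, and with what norm. All \<open>p\<close>
  are handled together by keeping constants independent of \<open>p\<close>: Jensen's inequality
  turns the pointwise kernel bound into an \<open>L_p\<close> bound whose constant is the
  \<open>L_1\<close> norm of \<open>ker\<close>. For \<open>p = \<infinity>\<close> membership
  demands continuity, and this shapes the bump. A plain cut-off \<phi> taken as the solution would
  leave a term \<open>q * \<phi>\<close> in \<open>f\<close>, which need be neither continuous nor
  in \<open>L_p\<close>. Multiplying \<phi> by the homogeneous solution \<open>exp Q\<close> cancels
  that term, and a continuously differentiable \<phi> makes \<open>f\<close> continuous, so one test
  pair serves every \<open>p\<close>. Almost constant \<open>Q\<close> means that the extra factor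
  distorts sizes only by a fixed constant. The numerical constants are not optimized; what matters
  is that the ratio of the norms is of order \<open>1 / a\<close>, wherever the interval
  lies.\<close>

subsection \<open>Differentiation of indefinite integrals\<close>

text \<open>Every bad point is the endpoint of arbitrarily short bad intervals. Henstock's lemma makes the total length
  of disjoint bad intervals small, and Vitali's lemma reduces the covering to disjoint ones.\<close>
lemma negligible_diff_quotient_bad:
  fixes h F :: "real \<Rightarrow> real"
  assumes h: "h integrable_on {a..b}"
    and F: "\<And>u v. a \<le> u \<Longrightarrow> u \<le> v \<Longrightarrow> v \<le> b \<Longrightarrow> F v - F u = integral {u..v} h"
    and c: "c > 0"
  shows "negligible {x\<in>{a..b}. \<forall>d>0. \<exists>v\<in>{a..b}. 0 < \<bar>v - x\<bar> \<and> \<bar>v - x\<bar> < d \<and>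
           c * \<bar>v - x\<bar> < \<bar>F v - F x - h x * (v - x)\<bar>}" (is "negligible ?B")
  unfolding negligible_outer_le
proof (intro allI impI)
  fix e :: real assume "e > 0"
  \<comment> \<open>The factor 5 pays for the enlargement in Vitali's lemma, and \<open>c\<close>
    converts the Henstock error of a bad interval into its length.\<close>
  define e' where "e' = c * e / 5"
  have "e' > 0" using \<open>e > 0\<close> c by (simp add: e'_def)
  have h': "h integrable_on cbox a b" using h by simp
  obtain \<gamma> where \<gamma>: "gauge \<gamma>"
    and hen: "\<And>p. \<lbrakk>p tagged_partial_division_of (cbox a b); \<gamma> fine p\<rbrakk> \<Longrightarrow>
             sum (\<lambda>(x,k). norm(measure lborel k *\<^sub>R h x - integral k h)) p < e'"
    using Henstock_lemma[OF h' \<open>e' > 0\<close>] by blast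
  define J :: "real \<times> real \<Rightarrow> real set" where "J = (\<lambda>(x,v). {min x v..max x v})"
  \<comment> \<open>An index remembers the tag \<open>x\<close> and the other endpoint
    \<open>v\<close>, which may lie on either side. Containment in \<open>\<gamma> x\<close> makes
    finite disjoint subfamilies fine partial divisions.\<close>
  define K where "K = {(x,v). x \<in> {a..b} \<and> v \<in> {a..b} \<and> x \<noteq> v \<and> J (x,v) \<subseteq> \<gamma> x \<and>
      c * \<bar>v - x\<bar> < \<bar>F v - F x - h x * (v - x)\<bar>}"
  define m where "m = (\<lambda>(x,v). (x+v)/2 :: real)"
  define r where "r = (\<lambda>(x,v). \<bar>v-x\<bar>/2 :: real)"
  have cb: "cball (m i) (r i) = J i" for i
    by (cases i) (auto simp: m_def r_def J_def cball_eq_atLeastAtMost min_def max_def field_simps)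
  have cover: "?B \<subseteq> (\<Union>i\<in>K. cball (m i) (r i))"
  proof
    fix x assume x: "x \<in> ?B"
    have "open (\<gamma> x)" "x \<in> \<gamma> x" using \<gamma> by (auto simp: gauge_def)
    then obtain d where d: "d > 0" "ball x d \<subseteq> \<gamma> x" using open_contains_ball by blast
    with x obtain v where v: "v \<in> {a..b}" "0 < \<bar>v - x\<bar>" "\<bar>v - x\<bar> < d"
        "c * \<bar>v - x\<bar> < \<bar>F v - F x - h x * (v - x)\<bar>" by blast
    have "J (x,v) \<subseteq> ball x d" using v by (auto simp: J_def dist_real_def min_def max_def split: if_splits)
    with d v x have "(x,v) \<in> K" by (auto simp: K_def)
    moreover have "x \<in> cball (m (x,v)) (r (x,v))" unfolding cb by (auto simp: J_def)
    ultimately show "x \<in> (\<Union>i\<in>K. cball (m i) (r i))" by blast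
  qed
  have rB: "0 < r i \<and> r i \<le> (b - a)" if "i \<in> K" for i
    using that by (cases i) (auto simp: K_def r_def)
  obtain C where C: "countable C" "C \<subseteq> K"
     and dis: "pairwise (\<lambda>i j. disjnt (cball (m i) (r i)) (cball (m j) (r j))) C"
     and sub: "?B \<subseteq> (\<Union>i\<in>C. cball (m i) (5 * r i))"
    using Vitali_covering_lemma_cballs[OF cover rB] by blast
  \<comment> \<open>Henstock's lemma speaks of finite divisions only; the bound is uniform in the
    finite subfamily, so it passes to the countable family \<open>C\<close>.\<close>
  have bound: "measure lebesgue (\<Union>i\<in>I. cball (m i) (5 * r i)) \<le> e"
    if I: "I \<subseteq> C" "finite I" for I
  proof -
    define T where "T = (\<lambda>i. (fst i, J i))"
    have IK: "I \<subseteq> K" using I C by blast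
    have inj: "inj_on T I"
    proof (rule inj_onI)
      fix i j assume ij: "i \<in> I" "j \<in> I" "T i = T j"
      have "\<not> disjnt (J i) (J j)"
        using ij by (cases i) (auto simp: T_def J_def disjnt_def)
      then show "i = j" using dis ij I unfolding cb pairwise_def by blast
    qed
    have "T ` I tagged_partial_division_of cbox a b"
      unfolding tagged_partial_division_of_def
    proof (intro conjI allI impI)
      show "finite (T ` I)" using I by simp
    next
      fix x k assume "(x,k) \<in> T ` I"
      then obtain v where v: "(x,v) \<in> I" "k = J (x,v)" by (auto simp: T_def)
      then show "x \<in> k" "k \<subseteq> cbox a b" "\<exists>a b. k = cbox a b"
        using IK by (auto simp: J_def K_def)
    next
      fix x1 K1 x2 K2 assume "(x1, K1) \<in> T ` I \<and> (x2, K2) \<in> T ` I \<and> (x1, K1) \<noteq> (x2, K2)"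
      then obtain i j where "i \<in> I" "j \<in> I" "K1 = J i" "K2 = J j" "i \<noteq> j" by (auto simp: T_def)
      then have "K1 \<inter> K2 = {}" using dis I unfolding cb pairwise_def disjnt_def by blast
      then show "interior K1 \<inter> interior K2 = {}" using interior_subset by blast
    qed
    moreover have "J i \<subseteq> \<gamma> (fst i)" if "i \<in> I" for i
      using IK that unfolding K_def by (cases i) auto
    then have "\<gamma> fine (T ` I)" by (simp add: fine_def T_def)
    ultimately have "sum (\<lambda>(x,k). norm(measure lborel k *\<^sub>R h x - integral k h)) (T ` I) < e'"
      by (rule hen)
    then have s: "(\<Sum>i\<in>I. norm(measure lborel (J i) *\<^sub>R h (fst i) - integral (J i) h)) < e'"
      unfolding sum.reindex[OF inj] by (simp add: T_def)
    have "c * (2 * r i) \<le> norm(measure lborel (J i) *\<^sub>R h (fst i) - integral (J i) h)" if "i \<in> I" for i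
    proof (cases i)
      case (Pair x v)
      with that IK have xv: "x \<in> {a..b}" "v \<in> {a..b}" "x \<noteq> v"
        "c * \<bar>v - x\<bar> < \<bar>F v - F x - h x * (v - x)\<bar>" by (auto simp: K_def)
      have "norm(measure lborel (J i) *\<^sub>R h (fst i) - integral (J i) h) = \<bar>F v - F x - h x * (v - x)\<bar>"
      proof (cases "x \<le> v")
        case True
        then show ?thesis using F[of x v] xv Pair by (simp add: J_def algebra_simps)
      next
        case False
        then have "integral (J i) h = F x - F v" using F[of v x] xv Pair by (simp add: J_def)
        then show ?thesis using False Pair by (simp add: J_def algebra_simps)
      qed
      then show ?thesis using xv Pair by (simp add: r_def)
    qed
    then have "(\<Sum>i\<in>I. c * (2 * r i)) \<le> (\<Sum>i\<in>I. norm(measure lborel (J i) *\<^sub>R h (fst i) - integral (J i) h))"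
      by (rule sum_mono)
    also note s
    finally have "(\<Sum>i\<in>I. c * (2 * r i)) < e'" .
    then have "c * (\<Sum>i\<in>I. 2 * r i) < e'" by (simp only: sum_distrib_left)
    then have "c * (\<Sum>i\<in>I. 2 * r i) < c * (e / 5)" by (simp add: e'_def)
    then have "(\<Sum>i\<in>I. 2 * r i) < e / 5" using c by (simp only: mult_less_cancel_left_pos)
    then have s2: "(\<Sum>i\<in>I. 10 * r i) < e" unfolding sum_distrib_left[symmetric] by simp
    have "measure lebesgue (\<Union>i\<in>I. cball (m i) (5 * r i)) \<le> (\<Sum>i\<in>I. measure lebesgue (cball (m i) (5 * r i)))"
      using I by (intro measure_UNION_le) auto
    also have "\<dots> = (\<Sum>i\<in>I. 10 * r i)"
    proof (rule sum.cong[OF refl])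
      fix i assume "i \<in> I"
      then have "r i > 0" using rB IK by blast
      then show "measure lebesgue (cball (m i) (5 * r i)) = 10 * r i"
        by (simp add: cball_eq_atLeastAtMost)
    qed
    finally show ?thesis using s2 by simp
  qed
  show "\<exists>T. ?B \<subseteq> T \<and> T \<in> lmeasurable \<and> measure lebesgue T \<le> e"
  proof (intro exI conjI)
    show "?B \<subseteq> (\<Union>i\<in>C. cball (m i) (5 * r i))" by (rule sub)
    show "(\<Union>i\<in>C. cball (m i) (5 * r i)) \<in> lmeasurable"
      by (rule fmeasurable_UN_bound[OF C(1) _ bound]) auto
    show "measure lebesgue (\<Union>i\<in>C. cball (m i) (5 * r i)) \<le> e"
      by (rule measure_UN_bound[OF C(1) _ bound]) auto
  qed
qed

text \<open>Where the derivative is not \<open>h x\<close>, the difference quotients miss it by more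
  than some \<open>1 / (k + 1)\<close> arbitrarily close by, so countably many negligible bad sets
  cover these points. The bad sets only see \<open>v\<close> inside \<open>{a..b}\<close>; at
  interior points that still decides the two-sided derivative.\<close>

lemma indefinite_integral_has_derivative_AE:
  fixes h F :: "real \<Rightarrow> real"
  assumes h: "h integrable_on {a..b}"
    and F: "\<And>u v. a \<le> u \<Longrightarrow> u \<le> v \<Longrightarrow> v \<le> b \<Longrightarrow> F v - F u = integral {u..v} h"
  shows "negligible {x\<in>{a<..<b}. \<not> (F has_real_derivative h x) (at x)}"
proof -
  define B where "B = (\<lambda>k::nat. {x\<in>{a..b}. \<forall>d>0. \<exists>v\<in>{a..b}. 0 < \<bar>v - x\<bar> \<and> \<bar>v - x\<bar> < d \<and>
           inverse (real (Suc k)) * \<bar>v - x\<bar> < \<bar>F v - F x - h x * (v - x)\<bar>})"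
  have "negligible (B k)" for k
    unfolding B_def by (rule negligible_diff_quotient_bad[OF h F]) auto
  then have "negligible (\<Union>k. B k)" using negligible_countable_Union[of "range B"] by auto
  moreover have "{x\<in>{a<..<b}. \<not> (F has_real_derivative h x) (at x)} \<subseteq> (\<Union>k. B k)"
  proof (safe, rule ccontr)
    fix x assume x: "x \<in> {a<..<b}" "x \<notin> (\<Union>k. B k)" and n: "\<not> (F has_real_derivative h x) (at x)"
    have "(F has_real_derivative h x) (at x within {a<..<b})"
      unfolding has_field_derivative_def has_derivative_within_alt
    proof (intro conjI allI impI)
      show "bounded_linear ((*) (h x))" by (rule bounded_linear_mult_right)
    next
      fix e :: real assume "e > 0"
      then obtain k where k: "inverse (real (Suc k)) < e" using reals_Archimedean by blast
      have "x \<notin> B k" "x \<in> {a..b}" using x by auto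
      then obtain d where d: "d > 0" "\<And>v. v \<in> {a..b} \<Longrightarrow> 0 < \<bar>v - x\<bar> \<Longrightarrow> \<bar>v - x\<bar> < d \<Longrightarrow>
           \<not> inverse (real (Suc k)) * \<bar>v - x\<bar> < \<bar>F v - F x - h x * (v - x)\<bar>"
        unfolding B_def by blast
      show "\<exists>d>0. \<forall>y\<in>{a<..<b}. norm (y - x) < d \<longrightarrow> norm (F y - F x - h x * (y - x)) \<le> e * norm (y - x)"
      proof (intro exI[of _ d] conjI ballI impI)
        fix y assume y: "y \<in> {a<..<b}" "norm (y - x) < d"
        show "norm (F y - F x - h x * (y - x)) \<le> e * norm (y - x)"
        proof (cases "y = x")
          case False
          then have "\<bar>F y - F x - h x * (y - x)\<bar> \<le> inverse (real (Suc k)) * \<bar>y - x\<bar>"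
            using d(2)[of y] y by auto
          also have "\<dots> \<le> e * \<bar>y - x\<bar>" using k by (intro mult_right_mono) auto
          finally show ?thesis by simp
        qed simp
      qed (rule d)
    qed
    then show False using n x by (simp add: at_within_open[OF _ open_greaterThanLessThan])
  qed
  ultimately show ?thesis by (rule negligible_subset)
qed

subsection \<open>Absolutely continuous functions\<close>

text \<open>Take a tagged division that is fine enough for the zero derivative at tags outside \<open>N\<close> and stays in a thin open
  neighbourhood of \<open>N\<close> at tags in \<open>N\<close>. The first kind of intervals contributes little by differentiability,
  the second by absolute continuity. Degenerate intervals may sit inside other ones, hence are put into \<open>p1\<close>.\<close>
lemma abs_cont_on_imp_eq:
  fixes z :: "real \<Rightarrow> real"
  assumes ab: "a \<le> b" and z: "abs_cont_on a b z"
    and N: "negligible N"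
    and der: "\<And>x. x \<in> {a..b} - N \<Longrightarrow> (z has_real_derivative 0) (at x)"
  shows "z a = z b"
proof (rule ccontr)
  assume ne: "z a \<noteq> z b"
  \<comment> \<open>The two kinds of intervals contribute at most
    \<open>\<epsilon> * (b - a)\<close> and \<open>\<epsilon>\<close>; the 2 in the denominator
    makes the total strictly smaller than \<open>\<bar>z b - z a\<bar>\<close>.\<close>
  define \<epsilon> where "\<epsilon> = \<bar>z b - z a\<bar> / (b - a + 2)"
  have \<epsilon>: "\<epsilon> > 0" using ne ab by (auto simp: \<epsilon>_def)
  obtain \<delta> where \<delta>: "\<delta> > 0" "\<And>(n::nat) l r. \<lbrakk>\<forall>i<n. a \<le> l i \<and> l i \<le> r i \<and> r i \<le> b;
        \<forall>i<n. \<forall>j<n. i \<noteq> j \<longrightarrow> r i \<le> l j \<or> r j \<le> l i; (\<Sum>i<n. r i - l i) < \<delta>\<rbrakk> \<Longrightarrow>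
        (\<Sum>i<n. \<bar>z (r i) - z (l i)\<bar>) < \<epsilon>"
    using z[unfolded abs_cont_on_def, rule_format, OF \<epsilon>] by blast
  have Nl: "N \<in> sets lebesgue" "measure lebesgue N = 0"
    using N by (auto simp: negligible_iff_measure)
  obtain U where U: "open U" "N \<subseteq> U" "U - N \<in> lmeasurable" "emeasure lebesgue (U - N) < ennreal \<delta>"
    using sets_lebesgue_outer_open[OF Nl(1) \<delta>(1)] by blast
  have "U = (U - N) \<union> N" using U by blast
  then have Um: "U \<in> lmeasurable" using U(3) negligible_imp_measurable[OF N] fmeasurable.Un by metis
  have "measure lebesgue (U - N) < \<delta>" using U(4) emeasure_eq_measure2[OF U(3)] by (simp add: ennreal_less_iff)
  then have U\<delta>: "measure lebesgue U < \<delta>"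
    using measure_Un_le[of "U - N" lebesgue N] \<open>U = (U - N) \<union> N\<close>[symmetric] U(3) Nl by (simp add: fmeasurableD)
  have "\<exists>d. \<forall>x. d x > 0 \<and> (x \<in> {a..b} - N \<longrightarrow> (\<forall>y. \<bar>y - x\<bar> < d x \<longrightarrow> \<bar>z y - z x\<bar> \<le> \<epsilon> * \<bar>y - x\<bar>))
         \<and> (x \<in> N \<longrightarrow> ball x (d x) \<subseteq> U)"
  proof (rule choice, rule allI)
    fix x
    consider "x \<in> N" | "x \<in> {a..b} - N" | "x \<notin> N" "x \<notin> {a..b}" by blast
    then show "\<exists>d. d > 0 \<and> (x \<in> {a..b} - N \<longrightarrow> (\<forall>y. \<bar>y - x\<bar> < d \<longrightarrow> \<bar>z y - z x\<bar> \<le> \<epsilon> * \<bar>y - x\<bar>))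
         \<and> (x \<in> N \<longrightarrow> ball x d \<subseteq> U)"
    proof cases
      case 1
      then show ?thesis using U(1,2) open_contains_ball by blast
    next
      case 2
      from der[OF 2] \<epsilon> obtain d where "d > 0" "\<And>y. norm (y - x) < d \<Longrightarrow> norm (z y - z x - 0 * (y - x)) \<le> \<epsilon> * norm (y - x)"
        unfolding has_field_derivative_def has_derivative_at_alt by blast
      then show ?thesis using 2 by (intro exI[of _ d]) auto
    next
      case 3
      then show ?thesis by (auto intro: exI[of _ 1])
    qed
  qed
  then obtain d where d: "\<And>x. d x > 0"
    "\<And>x y. x \<in> {a..b} - N \<Longrightarrow> \<bar>y - x\<bar> < d x \<Longrightarrow> \<bar>z y - z x\<bar> \<le> \<epsilon> * \<bar>y - x\<bar>"
    "\<And>x. x \<in> N \<Longrightarrow> ball x (d x) \<subseteq> U" by blast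
  have "gauge (\<lambda>x. ball x (d x))" using d(1) by (simp add: gauge_ball_dependent)
  then obtain p where p: "p tagged_division_of {a..b}" "(\<lambda>x. ball x (d x)) fine p"
    using fine_division_exists_real by blast
  note pD = tagged_division_ofD[OF p(1)]
  have fin: "finite p" by (rule pD)
  define D where "D = (\<lambda>(x::real,K). z (Sup K) - z (Inf K))"
  have K: "\<exists>u v. K = {u..v} \<and> u \<le> x \<and> x \<le> v \<and> a \<le> u \<and> v \<le> b \<and> {u..v} \<subseteq> ball x (d x) \<and>
      Inf K = u \<and> Sup K = v \<and> measure lborel K = v - u" if xK: "(x,K) \<in> p" for x K
  proof -
    obtain u v where "K = {u..v}" using pD(4)[OF xK] by auto
    moreover have "x \<in> K" "K \<subseteq> {a..b}" "K \<subseteq> ball x (d x)"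
      using pD(2,3)[OF xK] p(2) xK by (auto simp: fine_def)
    ultimately show ?thesis by (intro exI[of _ u] exI[of _ v]) auto
  qed
  define p1 where "p1 = {i\<in>p. fst i \<notin> N \<or> Inf (snd i) = Sup (snd i)}"
  define p2 where "p2 = {i\<in>p. fst i \<in> N \<and> Inf (snd i) \<noteq> Sup (snd i)}"
  have "\<bar>z b - z a\<bar> = \<bar>sum D p\<bar>"
    using additive_tagged_division_1[OF ab p(1), of z] by (simp add: D_def)
  also have "sum D p = sum D p1 + sum D p2"
    using fin unfolding p1_def p2_def by (subst sum.union_disjoint[symmetric]) (auto intro: sum.cong)
  also have "\<bar>sum D p1 + sum D p2\<bar> \<le> \<bar>sum D p1\<bar> + \<bar>sum D p2\<bar>" by simp
  also have "\<bar>sum D p1\<bar> \<le> \<epsilon> * (b - a)"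
  proof -
    have "\<bar>sum D p1\<bar> \<le> (\<Sum>i\<in>p1. \<bar>D i\<bar>)" by (rule sum_abs)
    also have "\<dots> \<le> (\<Sum>i\<in>p1. \<epsilon> * measure lborel (snd i))"
    proof (rule sum_mono)
      fix i assume i: "i \<in> p1"
      obtain x k where xk: "i = (x,k)" by (cases i)
      with i have x: "(x,k) \<in> p" "x \<notin> N \<or> Inf k = Sup k" by (auto simp: p1_def)
      from K[OF x(1)] obtain u v where uv: "k = {u..v}" "u \<le> x" "x \<le> v" "a \<le> u" "v \<le> b" "{u..v} \<subseteq> ball x (d x)"
        "Inf k = u" "Sup k = v" "measure lborel k = v - u" by blast
      have "\<bar>z v - z u\<bar> \<le> \<epsilon> * (v - u)"
      proof (cases "u = v")
        case False
        then have "x \<in> {a..b} - N" using x uv by auto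
        moreover have "{u,v} \<subseteq> {u..v}" using uv by auto
        then have "{u,v} \<subseteq> ball x (d x)" using uv(6) by (rule order_trans)
        ultimately have "\<bar>z u - z x\<bar> \<le> \<epsilon> * \<bar>u - x\<bar>" "\<bar>z v - z x\<bar> \<le> \<epsilon> * \<bar>v - x\<bar>"
          using d(2)[of x u] d(2)[of x v] by (simp_all add: dist_real_def abs_minus_commute)
        then show "\<bar>z v - z u\<bar> \<le> \<epsilon> * (v - u)" using uv by (auto simp: algebra_simps)
      qed simp
      then show "\<bar>D i\<bar> \<le> \<epsilon> * measure lborel (snd i)" using xk uv by (simp add: D_def)
    qed
    also have "\<dots> \<le> (\<Sum>i\<in>p. \<epsilon> * measure lborel (snd i))"
      using \<epsilon> fin by (intro sum_mono2) (auto simp: p1_def)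
    also have "\<dots> = \<epsilon> * (\<Sum>(x,k)\<in>p. measure lborel k)" by (simp add: sum_distrib_left case_prod_beta)
    also have "(\<Sum>(x,k)\<in>p. measure lborel k) = b - a"
      using additive_content_tagged_division[of p a b] p(1) ab by simp
    finally show ?thesis by simp
  qed
  also have "\<bar>sum D p2\<bar> \<le> \<epsilon>"
  proof -
    have fin2: "finite p2" using fin by (simp add: p2_def)
    obtain g where g: "bij_betw g {..<card p2} p2" using ex_bij_betw_nat_finite[OF fin2] atLeast0LessThan by metis
    have gin: "g i \<in> p2" if "i < card p2" for i using g that by (auto simp: bij_betw_def)
    define l r where "l i = Inf (snd (g i))" and "r i = Sup (snd (g i))" for i
    have lr: "\<exists>x. (x, {l i..r i}) \<in> p2 \<and> g i = (x, {l i..r i}) \<and> a \<le> l i \<and> l i < r i \<and>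
        l i \<le> x \<and> x \<le> r i \<and> r i \<le> b \<and> {l i..r i} \<subseteq> U"
      if "i < card p2" for i
    proof -
      obtain x k where xk: "g i = (x,k)" by (cases "g i")
      with gin[OF that] have x: "(x,k) \<in> p" "x \<in> N" "Inf k \<noteq> Sup k" by (auto simp: p2_def)
      from K[OF x(1)] obtain u v where uv: "k = {u..v}" "u \<le> x" "x \<le> v" "a \<le> u" "v \<le> b" "{u..v} \<subseteq> ball x (d x)"
        "Inf k = u" "Sup k = v" "measure lborel k = v - u" by blast
      then show ?thesis using d(3)[OF x(2)] xk x by (intro exI[of _ x]) (auto simp: l_def r_def p2_def)
    qed
    have O1: "\<forall>i<card p2. a \<le> l i \<and> l i \<le> r i \<and> r i \<le> b"
      using lr by (meson order_trans)
    have O2: "\<forall>i<card p2. \<forall>j<card p2. i \<noteq> j \<longrightarrow> r i \<le> l j \<or> r j \<le> l i"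
    proof (intro allI impI)
      fix i j assume ij: "i < card p2" "j < card p2" "i \<noteq> j"
      obtain x y where x: "(x, {l i..r i}) \<in> p2" "g i = (x, {l i..r i})"
        and y: "(y, {l j..r j}) \<in> p2" "g j = (y, {l j..r j})"
        and le: "l i < r i" "l j < r j" using lr[OF ij(1)] lr[OF ij(2)] by (meson order_trans)
      have "g i \<noteq> g j" using g ij by (auto simp: bij_betw_def inj_on_def)
      then have "interior {l i..r i} \<inter> interior {l j..r j} = {}"
        using pD(5)[of x "{l i..r i}" y "{l j..r j}"] x y by (auto simp: p2_def)
      then have e: "{l i<..<r i} \<inter> {l j<..<r j} = {}" by simp
      show "r i \<le> l j \<or> r j \<le> l i"
      proof (rule ccontr)
        assume "\<not> ?thesis"
        then have "max (l i) (l j) < min (r i) (r j)" using le by simp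
        then obtain w where "max (l i) (l j) < w" "w < min (r i) (r j)" using dense by blast
        then have "w \<in> {l i<..<r i} \<inter> {l j<..<r j}" by auto
        with e show False by blast
      qed
    qed
    have "sum D p2 = (\<Sum>i<card p2. D (g i))" by (rule sum.reindex_bij_betw[OF g, symmetric])
    also have "\<bar>\<dots>\<bar> \<le> (\<Sum>i<card p2. \<bar>D (g i)\<bar>)" by (rule sum_abs)
    also have "\<dots> = (\<Sum>i<card p2. \<bar>z (r i) - z (l i)\<bar>)"
      by (simp add: D_def l_def r_def case_prod_beta)
    also have "\<dots> < \<epsilon>"
    proof (rule \<delta>(2))
      have "(\<Sum>i<card p2. r i - l i) = (\<Sum>i<card p2. measure lebesgue {l i..r i})"
        using O1 by (intro sum.cong) auto
      also have "\<dots> = measure lebesgue (\<Union>i<card p2. {l i..r i})"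
      proof (rule measure_negligible_finite_Union_image[symmetric])
        show "pairwise (\<lambda>i j. negligible ({l i..r i} \<inter> {l j..r j})) {..<card p2}"
        proof (rule pairwiseI)
          fix i j assume "i \<in> {..<card p2}" "j \<in> {..<card p2}" "i \<noteq> j"
          then have "{l i..r i} \<inter> {l j..r j} \<subseteq> {r i, r j}" using O2 by force
          then show "negligible ({l i..r i} \<inter> {l j..r j})" by (rule negligible_subset[rotated]) simp
        qed
      qed auto
      also have "\<dots> \<le> measure lebesgue U"
      proof (rule measure_mono_fmeasurable[OF _ _ Um])
        show "(\<Union>i<card p2. {l i..r i}) \<subseteq> U" using lr by blast
      qed (intro sets.finite_UN, auto)
      finally show "(\<Sum>i<card p2. r i - l i) < \<delta>" using U\<delta> by simp
    qed (use O1 O2 in auto)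
    finally show ?thesis by simp
  qed
  finally have "\<bar>z b - z a\<bar> \<le> \<epsilon> * (b - a + 1)" by (simp add: algebra_simps)
  also have "\<dots> < \<epsilon> * (b - a + 2)" using \<epsilon> by simp
  also have "\<dots> = \<bar>z b - z a\<bar>" using ab by (simp add: \<epsilon>_def)
  finally show False by simp
qed

text \<open>A single domination principle behind sums, products and exponentials: each of these has
  increments controlled, on a bounded interval, by the increments of its ingredients.\<close>

lemma abs_cont_on_combine:
  assumes u: "abs_cont_on a b u" and v: "abs_cont_on a b v" and L: "L > 0"
    and le: "\<And>l r. a \<le> l \<Longrightarrow> l \<le> r \<Longrightarrow> r \<le> b \<Longrightarrow> \<bar>y r - y l\<bar> \<le> L * (\<bar>u r - u l\<bar> + \<bar>v r - v l\<bar>)"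
  shows "abs_cont_on a b y"
  unfolding abs_cont_on_def
proof (intro allI impI)
  fix \<epsilon> :: real assume "\<epsilon> > 0"
  define e where "e = \<epsilon> / (2 * L)"
  have e: "e > 0" using \<open>\<epsilon> > 0\<close> L by (simp add: e_def)
  from u e obtain d1 where d1: "d1 > 0" "\<And>(n::nat) l r. \<lbrakk>\<forall>i<n. a \<le> l i \<and> l i \<le> r i \<and> r i \<le> b;
        \<forall>i<n. \<forall>j<n. i \<noteq> j \<longrightarrow> r i \<le> l j \<or> r j \<le> l i; (\<Sum>i<n. r i - l i) < d1\<rbrakk> \<Longrightarrow>
        (\<Sum>i<n. \<bar>u (r i) - u (l i)\<bar>) < e" unfolding abs_cont_on_def by blast
  from v e obtain d2 where d2: "d2 > 0" "\<And>(n::nat) l r. \<lbrakk>\<forall>i<n. a \<le> l i \<and> l i \<le> r i \<and> r i \<le> b;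
        \<forall>i<n. \<forall>j<n. i \<noteq> j \<longrightarrow> r i \<le> l j \<or> r j \<le> l i; (\<Sum>i<n. r i - l i) < d2\<rbrakk> \<Longrightarrow>
        (\<Sum>i<n. \<bar>v (r i) - v (l i)\<bar>) < e" unfolding abs_cont_on_def by blast
  show "\<exists>\<delta>>0. \<forall>(n::nat) l r. (\<forall>i<n. a \<le> l i \<and> l i \<le> r i \<and> r i \<le> b) \<longrightarrow>
        (\<forall>i<n. \<forall>j<n. i \<noteq> j \<longrightarrow> r i \<le> l j \<or> r j \<le> l i) \<longrightarrow> (\<Sum>i<n. r i - l i) < \<delta> \<longrightarrow>
        (\<Sum>i<n. \<bar>y (r i) - y (l i)\<bar>) < \<epsilon>"
  proof (intro exI[of _ "min d1 d2"] conjI allI impI)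
    show "min d1 d2 > 0" using d1 d2 by simp
    fix n :: nat and l r :: "nat \<Rightarrow> real"
    assume A: "\<forall>i<n. a \<le> l i \<and> l i \<le> r i \<and> r i \<le> b" "\<forall>i<n. \<forall>j<n. i \<noteq> j \<longrightarrow> r i \<le> l j \<or> r j \<le> l i"
      "(\<Sum>i<n. r i - l i) < min d1 d2"
    have "(\<Sum>i<n. \<bar>y (r i) - y (l i)\<bar>) \<le> (\<Sum>i<n. L * (\<bar>u (r i) - u (l i)\<bar> + \<bar>v (r i) - v (l i)\<bar>))"
      using A(1) by (intro sum_mono le) auto
    also have "\<dots> = L * ((\<Sum>i<n. \<bar>u (r i) - u (l i)\<bar>) + (\<Sum>i<n. \<bar>v (r i) - v (l i)\<bar>))"
      by (simp only: sum_distrib_left[symmetric] sum.distrib)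
    also have "\<dots> < L * (e + e)"
      using d1(2)[OF A(1,2)] d2(2)[OF A(1,2)] A(3) L by (intro mult_strict_left_mono add_strict_mono) auto
    also have "\<dots> = \<epsilon>" using L by (simp add: e_def)
    finally show "(\<Sum>i<n. \<bar>y (r i) - y (l i)\<bar>) < \<epsilon>" .
  qed
qed

lemma abs_cont_combine:
  assumes "abs_cont u" "abs_cont v"
    and "\<And>a b. a \<le> b \<Longrightarrow> \<exists>L>0. \<forall>l\<in>{a..b}. \<forall>r\<in>{a..b}. \<bar>y r - y l\<bar> \<le> L * (\<bar>u r - u l\<bar> + \<bar>v r - v l\<bar>)"
  shows "abs_cont y"
  unfolding abs_cont_def
proof (intro allI impI)
  fix a b :: real assume ab: "a \<le> b"
  from assms(3)[OF ab] obtain L where L: "L > 0"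
    and le: "\<And>l r. l \<in> {a..b} \<Longrightarrow> r \<in> {a..b} \<Longrightarrow> \<bar>y r - y l\<bar> \<le> L * (\<bar>u r - u l\<bar> + \<bar>v r - v l\<bar>)"
    by meson
  have "abs_cont_on a b u" "abs_cont_on a b v" using assms(1,2) ab unfolding abs_cont_def by blast+
  then show "abs_cont_on a b y" by (rule abs_cont_on_combine[OF _ _ L le]) simp_all
qed

lemma abs_cont_imp_continuous:
  assumes "abs_cont y"
  shows "continuous_on UNIV y"
proof -
  have "isCont y x" for x
    unfolding continuous_at_eps_delta
  proof (intro allI impI)
    fix e :: real assume "e > 0"
    have "abs_cont_on (x-1) (x+1) y" using assms by (simp add: abs_cont_def)
    then obtain d where d: "d > 0" "\<And>(n::nat) l r. \<lbrakk>\<forall>i<n. x - 1 \<le> l i \<and> l i \<le> r i \<and> r i \<le> x + 1;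
        \<forall>i<n. \<forall>j<n. i \<noteq> j \<longrightarrow> r i \<le> l j \<or> r j \<le> l i; (\<Sum>i<n. r i - l i) < d\<rbrakk> \<Longrightarrow>
        (\<Sum>i<n. \<bar>y (r i) - y (l i)\<bar>) < e"
      using \<open>e > 0\<close> unfolding abs_cont_on_def by blast
    \<comment> \<open>A family consisting of one interval already gives continuity.\<close>
    have *: "\<bar>y v - y u\<bar> < e" if "x - 1 \<le> u" "u \<le> v" "v \<le> x + 1" "v - u < d" for u v
      using d(2)[of 1 "\<lambda>_. u" "\<lambda>_. v"] that by auto
    show "\<exists>d>0. \<forall>x'. dist x' x < d \<longrightarrow> dist (y x') (y x) < e"
    proof (intro exI[of _ "min d 1"] conjI allI impI)
      fix x' assume x': "dist x' x < min d 1"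
      show "dist (y x') (y x) < e"
      proof (cases "x \<le> x'")
        case True then show ?thesis using *[of x x'] x' by (simp add: dist_real_def)
      next
        case False then show ?thesis using *[of x' x] x' by (simp add: dist_real_def)
      qed
    qed (use d in simp)
  qed
  then show ?thesis by (simp add: continuous_on_eq_continuous_at)
qed

lemma bounded_on_interval_abs:
  fixes y :: "real \<Rightarrow> real"
  assumes "continuous_on UNIV y"
  obtains B where "B > 0" "\<And>x. x \<in> {a..b} \<Longrightarrow> \<bar>y x\<bar> \<le> B"
proof -
  have "compact (y ` {a..b})" using assms continuous_on_subset by (intro compact_continuous_image) auto
  then have "bounded (y ` {a..b})" by (rule compact_imp_bounded)
  then obtain B where "B > 0" "\<forall>w\<in>y ` {a..b}. norm w \<le> B" using bounded_pos by blast
  then show ?thesis using that by auto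
qed

lemma abs_cont_mult:
  assumes u: "abs_cont u" and v: "abs_cont v"
  shows "abs_cont (\<lambda>x. u x * v x)"
proof (rule abs_cont_combine[OF u v])
  fix a b :: real
  obtain A where A: "A > 0" "\<And>x. x \<in> {a..b} \<Longrightarrow> \<bar>u x\<bar> \<le> A"
    using bounded_on_interval_abs[OF abs_cont_imp_continuous[OF u]] by blast
  obtain B where B: "B > 0" "\<And>x. x \<in> {a..b} \<Longrightarrow> \<bar>v x\<bar> \<le> B"
    using bounded_on_interval_abs[OF abs_cont_imp_continuous[OF v]] by blast
  have "\<bar>u r * v r - u l * v l\<bar> \<le> (A + B) * (\<bar>u r - u l\<bar> + \<bar>v r - v l\<bar>)" if "l \<in> {a..b}" "r \<in> {a..b}" for l r
  proof -
    have "u r * v r - u l * v l = u r * (v r - v l) + v l * (u r - u l)" by (simp add: algebra_simps)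
    then have "\<bar>u r * v r - u l * v l\<bar> \<le> \<bar>u r\<bar> * \<bar>v r - v l\<bar> + \<bar>v l\<bar> * \<bar>u r - u l\<bar>"
      by (metis abs_mult abs_triangle_ineq)
    also have "\<dots> \<le> (A + B) * \<bar>v r - v l\<bar> + (A + B) * \<bar>u r - u l\<bar>"
      using A(2)[OF that(2)] B(2)[OF that(1)] A(1) B(1) by (intro add_mono mult_right_mono) auto
    finally show ?thesis by (simp add: algebra_simps)
  qed
  then show "\<exists>L>0. \<forall>l\<in>{a..b}. \<forall>r\<in>{a..b}. \<bar>u r * v r - u l * v l\<bar> \<le> L * (\<bar>u r - u l\<bar> + \<bar>v r - v l\<bar>)"
    using A B by (intro exI[of _ "A+B"]) auto
qed

lemma abs_cont_add:
  assumes u: "abs_cont u" and v: "abs_cont v"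
  shows "abs_cont (\<lambda>x. u x + v x)"
  by (rule abs_cont_combine[OF u v]) (intro exI[of _ 1], auto)

lemma abs_cont_const: "abs_cont (\<lambda>x. c)"
  unfolding abs_cont_def abs_cont_on_def by (auto intro: exI[of _ 1])

text \<open>The Lipschitz bound behind \<open>abs_cont_exp\<close>. It is the tangent inequality of
  the exponential at 0, multiplied by the larger of the two values.\<close>

lemma exp_diff_abs_le:
  fixes s t B :: real
  assumes "\<bar>s\<bar> \<le> B" "\<bar>t\<bar> \<le> B"
  shows "\<bar>exp s - exp t\<bar> \<le> exp B * \<bar>s - t\<bar>"
proof -
  have *: "\<bar>exp s - exp t\<bar> \<le> exp B * \<bar>s - t\<bar>" if "t \<le> s" "s \<le> B" for s t :: real
  proof -
    have "exp (t - s) \<ge> 1 + (t - s)" by (rule exp_ge_add_one_self)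
    then have "exp s * (1 - exp (t - s)) \<le> exp s * (s - t)" by (intro mult_left_mono) (linarith, simp)
    then have "exp s - exp t \<le> exp s * (s - t)" by (simp add: algebra_simps exp_diff)
    also have "\<dots> \<le> exp B * (s - t)" using that by (intro mult_right_mono) auto
    finally show ?thesis using that by simp
  qed
  show ?thesis using *[of s t] *[of t s] assms by (cases "s \<le> t") (auto simp: abs_minus_commute)
qed

lemma abs_cont_exp:
  assumes u: "abs_cont u"
  shows "abs_cont (\<lambda>x. exp (u x))"
proof (rule abs_cont_combine[OF u u])
  fix a b :: real
  obtain A where A: "A > 0" "\<And>x. x \<in> {a..b} \<Longrightarrow> \<bar>u x\<bar> \<le> A"
    using bounded_on_interval_abs[OF abs_cont_imp_continuous[OF u]] by blast
  have "\<bar>exp (u r) - exp (u l)\<bar> \<le> exp A * (\<bar>u r - u l\<bar> + \<bar>u r - u l\<bar>)" if "l \<in> {a..b}" "r \<in> {a..b}" for l r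
  proof -
    have "\<bar>exp (u r) - exp (u l)\<bar> \<le> exp A * \<bar>u r - u l\<bar>"
      by (intro exp_diff_abs_le A that)
    also have "\<dots> \<le> exp A * (\<bar>u r - u l\<bar> + \<bar>u r - u l\<bar>)" by (intro mult_left_mono) auto
    finally show ?thesis .
  qed
  then show "\<exists>L>0. \<forall>l\<in>{a..b}. \<forall>r\<in>{a..b}. \<bar>exp (u r) - exp (u l)\<bar> \<le> L * (\<bar>u r - u l\<bar> + \<bar>u r - u l\<bar>)"
    by (intro exI[of _ "exp A"]) auto
qed

text \<open>Truncating at height \<open>k\<close> splits \<open>\<bar>h\<bar>\<close> into a part with small integral and a bounded part.\<close>
lemma abs_cont_on_indefinite_integral:
  fixes h H :: "real \<Rightarrow> real"
  assumes h: "set_integrable lborel {a..b} h"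
    and H: "\<And>u v. a \<le> u \<Longrightarrow> u \<le> v \<Longrightarrow> v \<le> b \<Longrightarrow> H v - H u = (LINT t:{u..v}|lborel. h t)"
  shows "abs_cont_on a b H"
  unfolding abs_cont_on_def
proof (intro allI impI)
  fix \<epsilon> :: real assume \<epsilon>: "\<epsilon> > 0"
  define g where "g = (\<lambda>t. indicator {a..b} t *\<^sub>R h t)"
  have g: "integrable lborel g" using h by (simp add: g_def set_integrable_def)
  define w where "w = (\<lambda>(k::nat) t. max 0 (\<bar>g t\<bar> - real k))"
  have w: "integrable lborel (w k)" for k
    unfolding w_def by (rule Bochner_Integration.integrable_bound[OF g]) (use g in auto)
  have "(\<lambda>k. LINT t|lborel. w k t) \<longlonglongrightarrow> (LINT t::real|lborel. (0::real))"
  proof (rule integral_dominated_convergence[where M=lborel and s=w and f="\<lambda>t. 0" and w="\<lambda>t. \<bar>g t\<bar>"])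
    show "AE t in lborel. (\<lambda>k. w k t) \<longlonglongrightarrow> 0"
    proof (rule AE_I2)
      fix t
      obtain n where "\<bar>g t\<bar> \<le> real n" using real_arch_simple by blast
      then have "\<forall>\<^sub>F k in sequentially. w k t = 0"
        by (intro eventually_sequentiallyI[of n]) (auto simp: w_def)
      then show "(\<lambda>k. w k t) \<longlonglongrightarrow> 0" by (rule tendsto_eventually)
    qed
    show "integrable lborel (\<lambda>t. \<bar>g t\<bar>)" using g by simp
  qed (use g w in \<open>auto simp: w_def\<close>)
  then have "\<forall>\<^sub>F k in sequentially. (LINT t|lborel. w k t) < \<epsilon> / 2"
    using \<epsilon> by (intro order_tendstoD) auto
  then obtain k where k: "(LINT t|lborel. w k t) < \<epsilon> / 2" using eventually_sequentially by auto
  show "\<exists>\<delta>>0. \<forall>(n::nat) l r. (\<forall>i<n. a \<le> l i \<and> l i \<le> r i \<and> r i \<le> b) \<longrightarrow>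
        (\<forall>i<n. \<forall>j<n. i \<noteq> j \<longrightarrow> r i \<le> l j \<or> r j \<le> l i) \<longrightarrow> (\<Sum>i<n. r i - l i) < \<delta> \<longrightarrow>
        (\<Sum>i<n. \<bar>H (r i) - H (l i)\<bar>) < \<epsilon>"
  \<comment> \<open>The bounded part contributes at most \<open>k\<close> times the total length,
    hence at most half of \<epsilon>; the added 1 covers \<open>k = 0\<close>.\<close>
  proof (intro exI[of _ "\<epsilon> / (2 * (real k + 1))"] conjI allI impI)
    show "\<epsilon> / (2 * (real k + 1)) > 0" using \<epsilon> by simp
    fix n :: nat and l r :: "nat \<Rightarrow> real"
    assume A: "\<forall>i<n. a \<le> l i \<and> l i \<le> r i \<and> r i \<le> b" "\<forall>i<n. \<forall>j<n. i \<noteq> j \<longrightarrow> r i \<le> l j \<or> r j \<le> l i"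
      "(\<Sum>i<n. r i - l i) < \<epsilon> / (2 * (real k + 1))"
    \<comment> \<open>Half-open intervals: neighbours sharing an endpoint become disjoint, so their
      indicators add up to at most 1, while the integrals do not change.\<close>
    let ?I = "\<lambda>i. {l i<..r i}"
    have iw: "integrable lborel (\<lambda>t. indicator (?I i) t * w k t)" for i
      using integrable_real_mult_indicator[OF _ w[of k], of "?I i"] by (simp add: mult.commute)
    have 1: "\<bar>H (r i) - H (l i)\<bar> \<le> (LINT t|lborel. indicator (?I i) t * w k t) + real k * (r i - l i)" if i: "i < n" for i
    proof -
      have li: "a \<le> l i" "l i \<le> r i" "r i \<le> b" using A i by auto
      have "H (r i) - H (l i) = (LINT t:{l i..r i}|lborel. h t)" using H li by blast
      also have "\<dots> = (LINT t|lborel. indicator {l i..r i} t * g t)"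
        unfolding set_lebesgue_integral_def
        by (rule Bochner_Integration.integral_cong) (use li in \<open>auto simp: g_def indicator_def\<close>)
      also have "\<dots> = (LINT t|lborel. indicator (?I i) t * g t)"
      proof (rule integral_cong_AE)
        show "AE t in lborel. indicator {l i..r i} t * g t = indicator (?I i) t * g t"
          using AE_lborel_singleton[of "l i"] by eventually_elim (auto simp: indicator_def)
      qed (use g in auto)
      also have "\<bar>\<dots>\<bar> \<le> (LINT t|lborel. \<bar>indicator (?I i) t * g t\<bar>)" by (rule integral_abs_bound)
      also have "\<dots> \<le> (LINT t|lborel. indicator (?I i) t * w k t + real k * indicator (?I i) t)"
      proof (rule integral_mono)
        have "integrable lborel (\<lambda>t. g t * indicator (?I i) t)" by (rule integrable_real_mult_indicator[OF _ g]) auto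
        then show "integrable lborel (\<lambda>t. \<bar>indicator (?I i) t * g t\<bar>)" by (simp add: mult.commute)
        show "integrable lborel (\<lambda>t. indicator (?I i) t * w k t + real k * indicator (?I i) t)"
          using li by (intro Bochner_Integration.integrable_add iw integrable_mult_right integrable_real_indicator) auto
      qed (auto simp: w_def indicator_def)
      also have "\<dots> = (LINT t|lborel. indicator (?I i) t * w k t) + real k * (r i - l i)"
        using li by (subst Bochner_Integration.integral_add[OF iw]) auto
      finally show ?thesis .
    qed
    have "(\<Sum>i<n. \<bar>H (r i) - H (l i)\<bar>) \<le> (\<Sum>i<n. (LINT t|lborel. indicator (?I i) t * w k t) + real k * (r i - l i))"
      using 1 by (intro sum_mono) auto
    also have "\<dots> = (LINT t|lborel. (\<Sum>i<n. indicator (?I i) t * w k t)) + real k * (\<Sum>i<n. r i - l i)"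
      by (simp only: sum.distrib sum_distrib_left[symmetric] Bochner_Integration.integral_sum[OF iw])
    also have "(LINT t|lborel. (\<Sum>i<n. indicator (?I i) t * w k t)) \<le> (LINT t|lborel. w k t)"
    proof (rule integral_mono)
      show "integrable lborel (\<lambda>t. \<Sum>i<n. indicator (?I i) t * w k t)" using iw by (rule Bochner_Integration.integrable_sum)
      show "(\<Sum>i<n. indicator (?I i) t * w k t) \<le> w k t" for t
      proof -
        have "disjoint_family_on ?I {..<n}"
          unfolding disjoint_family_on_def
        proof (intro ballI impI)
          fix i j assume "i \<in> {..<n}" "j \<in> {..<n}" "i \<noteq> j"
          then have "r i \<le> l j \<or> r j \<le> l i" using A(2) by simp
          then show "?I i \<inter> ?I j = {}" by auto
        qed
        then have "(\<Sum>i<n. indicator (?I i) t) = (indicator (\<Union>i<n. ?I i) t :: real)"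
          by (subst indicator_UN_disjoint) auto
        also have "\<dots> \<le> 1" by (simp add: indicator_def)
        finally have "(\<Sum>i<n. indicator (?I i) t) * w k t \<le> 1 * w k t"
          by (intro mult_right_mono) (auto simp: w_def)
        then show ?thesis by (simp only: sum_distrib_right mult_1)
      qed
    qed (rule w)
    also have "(LINT t|lborel. w k t) + real k * (\<Sum>i<n. r i - l i) < \<epsilon> / 2 + \<epsilon> / 2"
    proof (rule add_less_le_mono[OF k])
      have "real k * (\<Sum>i<n. r i - l i) \<le> (real k + 1) * (\<epsilon> / (2 * (real k + 1)))"
        using A by (intro mult_mono) (auto intro!: sum_nonneg)
      also have "\<dots> = \<epsilon> / 2" by (simp add: divide_simps)
      finally show "real k * (\<Sum>i<n. r i - l i) \<le> \<epsilon> / 2" .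
    qed
    finally show "(\<Sum>i<n. \<bar>H (r i) - H (l i)\<bar>) < \<epsilon>" by simp
  qed
qed

subsection \<open>Primitives and the integrating factor\<close>

text \<open>Only increments are prescribed, which leaves the additive constant free:
  \<open>primitive_exists\<close> normalizes at 0, whereas the Green operator calls for minus a tail
  integral. The order \<open>u \<le> v\<close> is essential because the set integral over an empty
  interval is 0 and not a signed integral.\<close>

definition primitive_of :: "(real \<Rightarrow> real) \<Rightarrow> (real \<Rightarrow> real) \<Rightarrow> bool" where
  "primitive_of h H \<longleftrightarrow> (\<forall>u v. u \<le> v \<longrightarrow> H v - H u = (LINT t:{u..v}|lborel. h t))"

definition locally_integrable :: "(real \<Rightarrow> real) \<Rightarrow> bool" where
  "locally_integrable h \<longleftrightarrow> (\<forall>a b. set_integrable lborel {a..b} h)"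

lemma primitive_ofD: "primitive_of h H \<Longrightarrow> u \<le> v \<Longrightarrow> H v - H u = (LINT t:{u..v}|lborel. h t)"
  by (simp add: primitive_of_def)

lemma locally_integrableD: "locally_integrable h \<Longrightarrow> set_integrable lborel {a..b} h"
  by (simp add: locally_integrable_def)

lemma abs_cont_primitive:
  assumes "locally_integrable h" "primitive_of h H"
  shows "abs_cont H"
  unfolding abs_cont_def
proof (intro allI impI)
  fix a b :: real
  show "abs_cont_on a b H"
    by (rule abs_cont_on_indefinite_integral[OF locally_integrableD[OF assms(1)] primitive_ofD[OF assms(2)]])
qed

lemma primitive_has_derivative_AE:
  assumes h: "locally_integrable h" and H: "primitive_of h H"
  shows "AE x in lborel. (H has_real_derivative h x) (at x)"
proof -
  define N where "N = (\<lambda>n::nat. {x\<in>{-real n<..<real n}. \<not> (H has_real_derivative h x) (at x)})"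
  have "negligible (N n)" for n
    unfolding N_def
  proof (rule indefinite_integral_has_derivative_AE)
    show "h integrable_on {- real n..real n}"
      using set_borel_integral_eq_integral(1)[OF locally_integrableD[OF h]] .
    show "H v - H u = integral {u..v} h" if "u \<le> v" for u v
      using set_borel_integral_eq_integral(2)[OF locally_integrableD[OF h], of u v] primitive_ofD[OF H that] by simp
  qed
  then have "negligible (\<Union>n. N n)" using negligible_countable_Union[of "range N"] by auto
  then have "(\<Union>n. N n) \<in> null_sets lebesgue" by (simp add: negligible_iff_null_sets)
  moreover have "{x \<in> space lebesgue. \<not> (H has_real_derivative h x) (at x)} \<subseteq> (\<Union>n. N n)"
  proof safe
    fix x assume "\<not> (H has_real_derivative h x) (at x)"
    moreover obtain n where "\<bar>x\<bar> < real n" using reals_Archimedean2 by blast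
    ultimately show "x \<in> (\<Union>n. N n)" by (auto simp: N_def abs_less_iff intro!: exI[of _ n])
  qed
  ultimately have "AE x in lebesgue. (H has_real_derivative h x) (at x)" by (rule AE_I')
  then show ?thesis by (simp add: AE_completion_iff)
qed

lemma abs_cont_zero_derivative_AE:
  assumes z: "abs_cont z" and der: "AE x in lborel. (z has_real_derivative 0) (at x)"
  shows "z u = z v"
proof -
  from der obtain N where N: "N \<in> null_sets lborel" "{x \<in> space lborel. \<not> (z has_real_derivative 0) (at x)} \<subseteq> N"
    unfolding eventually_ae_filter by blast
  have neg: "negligible N" using N(1) by (simp add: negligible_iff_null_sets null_sets_completionI)
  have *: "z a = z b" if "a \<le> b" for a b
  proof (rule abs_cont_on_imp_eq[OF that _ neg])
    show "abs_cont_on a b z" using z that by (simp add: abs_cont_def)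
    show "(z has_real_derivative 0) (at x)" if "x \<in> {a..b} - N" for x
      using N(2) that by auto
  qed
  show ?thesis using *[of u v] *[of v u] by linarith
qed

lemma set_integral_combine_Icc:
  fixes h :: "real \<Rightarrow> real"
  assumes h: "locally_integrable h" and "u \<le> v" "v \<le> w"
  shows "(LINT t:{u..w}|lborel. h t) = (LINT t:{u..v}|lborel. h t) + (LINT t:{v..w}|lborel. h t)"
proof -
  have "integral {u..v} h + integral {v..w} h = integral {u..w} h"
    using assms(2,3) set_borel_integral_eq_integral(1)[OF locally_integrableD[OF h]]
    by (rule Henstock_Kurzweil_Integration.integral_combine)
  then show ?thesis by (simp add: set_borel_integral_eq_integral(2)[OF locally_integrableD[OF h]])
qed

lemma set_integral_singleton: "(LINT t:{u}|lborel. h t) = (0::real)" for u :: real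
  unfolding set_lebesgue_integral_def
  by (rule integral_eq_zero_AE) (use AE_lborel_singleton[of u] in \<open>auto elim!: eventually_mono\<close>)

lemma primitive_exists:
  fixes h :: "real \<Rightarrow> real"
  assumes h: "locally_integrable h"
  obtains H where "primitive_of h H" "H 0 = 0"
proof -
  \<comment> \<open>The signed integral from 0 to \<open>x\<close> without a case distinction: one
    of the two intervals always shrinks to the point 0.\<close>
  define H where "H x = (LINT t:{0..max 0 x}|lborel. h t) - (LINT t:{min 0 x..0}|lborel. h t)" for x
  have "H v - H u = (LINT t:{u..v}|lborel. h t)" if "u \<le> v" for u v
  proof -
    consider "0 \<le> u" | "u \<le> 0" "0 \<le> v" | "v \<le> 0" by linarith
    then show ?thesis
    proof cases
      case 1 then show ?thesis using that set_integral_combine_Icc[OF h 1 that]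
        by (simp add: H_def set_integral_singleton)
    next
      case 2 then show ?thesis using set_integral_combine_Icc[OF h 2]
        by (simp add: H_def set_integral_singleton)
    next
      case 3 then show ?thesis using that set_integral_combine_Icc[OF h that 3]
        by (simp add: H_def set_integral_singleton)
    qed
  qed
  then have "primitive_of h H" by (simp add: primitive_of_def)
  moreover have "H 0 = 0" by (simp add: H_def set_integral_singleton)
  ultimately show ?thesis by (rule that)
qed

lemma locally_integrable_continuous_mult:
  assumes c: "continuous_on UNIV c" and h: "locally_integrable h"
  shows "locally_integrable (\<lambda>x. c x * h x)"
  unfolding locally_integrable_def set_integrable_def
proof (intro allI)
  fix a b :: real
  obtain B where B: "B > 0" "\<And>x. x \<in> {a..b} \<Longrightarrow> \<bar>c x\<bar> \<le> B"
    using bounded_on_interval_abs[OF c] by blast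
  have g: "integrable lborel (\<lambda>x. indicator {a..b} x *\<^sub>R h x)"
    using locally_integrableD[OF h] by (simp add: set_integrable_def)
  have cm: "c \<in> borel_measurable borel" using c by (rule borel_measurable_continuous_onI)
  have "integrable lborel (\<lambda>x. c x * (indicator {a..b} x *\<^sub>R h x))"
  proof (rule Bochner_Integration.integrable_bound)
    show "integrable lborel (\<lambda>x. B * (indicator {a..b} x *\<^sub>R h x))" using g by simp
    show "(\<lambda>x. c x * (indicator {a..b} x *\<^sub>R h x)) \<in> borel_measurable lborel"
      using cm g by (intro borel_measurable_times) auto
    show "AE x in lborel. norm (c x * (indicator {a..b} x *\<^sub>R h x)) \<le> norm (B * (indicator {a..b} x *\<^sub>R h x))"
      using B by (intro AE_I2) (auto simp: indicator_def abs_mult intro!: mult_right_mono)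
  qed
  then show "integrable lborel (\<lambda>x. indicator {a..b} x *\<^sub>R (c x * h x))"
    by (simp add: mult.left_commute)
qed

text \<open>The integrating factor \<open>exp (- Q)\<close> turns the equation into \<open>(y exp (- Q))' = - exp (- Q) f\<close>.\<close>
lemma is_solution_iff:
  assumes q: "locally_integrable q" and Q: "primitive_of q Q"
    and f: "locally_integrable f" and H: "primitive_of (\<lambda>t. exp (- Q t) * f t) H"
  shows "is_solution q f y \<longleftrightarrow> (\<exists>c. \<forall>x. y x = exp (Q x) * (c - H x))"
proof -
  have Qac: "abs_cont Q" by (rule abs_cont_primitive[OF q Q])
  have mQac: "abs_cont (\<lambda>x. - Q x)" using abs_cont_mult[OF abs_cont_const[of "-1"] Qac] by simp
  have "continuous_on UNIV (\<lambda>x. exp (- Q x))"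
    by (rule abs_cont_imp_continuous[OF abs_cont_exp[OF mQac]])
  then have loc: "locally_integrable (\<lambda>t. exp (- Q t) * f t)"
    using f by (rule locally_integrable_continuous_mult)
  have Hac: "abs_cont H" by (rule abs_cont_primitive[OF loc H])
  have Qd: "AE x in lborel. (Q has_real_derivative q x) (at x)" by (rule primitive_has_derivative_AE[OF q Q])
  have Hd: "AE x in lborel. (H has_real_derivative exp (- Q x) * f x) (at x)"
    by (rule primitive_has_derivative_AE[OF loc H])
  show ?thesis
  proof
    assume sol: "is_solution q f y"
    define z where "z x = y x * exp (- Q x) + H x" for x
    have "abs_cont z" unfolding z_def
      using sol by (intro abs_cont_add abs_cont_mult abs_cont_exp mQac Hac) (simp add: is_solution_def)
    moreover have "AE x in lborel. (z has_real_derivative 0) (at x)"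
    proof -
      have "AE x in lborel. \<exists>D. (y has_real_derivative D) (at x) \<and> - D + q x * y x = f x"
        using sol by (simp add: is_solution_def)
      then show ?thesis using Qd Hd
      proof eventually_elim
        case (elim x)
        then obtain D where D: "(y has_real_derivative D) (at x)" "f x = - D + q x * y x" by auto
        show ?case unfolding z_def
          by (rule derivative_eq_intros D elim refl)+ (simp add: D(2) algebra_simps)
      qed
    qed
    ultimately have "z x = z 0" for x by (rule abs_cont_zero_derivative_AE)
    then have "y x = exp (Q x) * (z 0 - H x)" for x
      unfolding z_def by (metis add_diff_cancel_right' exp_minus_inverse mult.left_commute mult.right_neutral)
    then show "\<exists>c. \<forall>x. y x = exp (Q x) * (c - H x)" by blast
  next
    assume "\<exists>c. \<forall>x. y x = exp (Q x) * (c - H x)"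
    then obtain c where "\<And>x. y x = exp (Q x) * (c - H x)" by blast
    \<comment> \<open>Written with a sum and a factor -1 to match the closure rules for absolute
      continuity.\<close>
    then have y: "y = (\<lambda>x. exp (Q x) * (c + (-1) * H x))" by auto
    have "abs_cont y" unfolding y
      by (intro abs_cont_mult abs_cont_exp abs_cont_add abs_cont_const Qac Hac)
    moreover have "AE x in lborel. \<exists>D. (y has_real_derivative D) (at x) \<and> - D + q x * y x = f x"
      using Qd Hd
    proof eventually_elim
      case (elim x)
      have "(y has_real_derivative (q x * y x - f x)) (at x)"
        unfolding y
        by (rule derivative_eq_intros elim refl)+ (simp add: algebra_simps exp_minus)
      then show ?case by (intro exI conjI) auto
    qed
    ultimately show "is_solution q f y" by (simp add: is_solution_def)
  qed
qed

subsection \<open>Convolution estimates\<close>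

text \<open>This replaces Hoelder's inequality: a function with integrable \<open>P\<close>-th power
  is integrable against any bounded weight of finite mass, such as an interval indicator or a
  shifted \<open>ker\<close>.\<close>

lemma abs_le_one_plus_powr:
  fixes s P :: real
  assumes "s \<ge> 0" "P \<ge> 1"
  shows "s \<le> 1 + s powr P"
proof (cases "s \<le> 1")
  case True
  then show ?thesis using powr_ge_zero[of s P] by linarith
next
  case False
  then have "s powr 1 \<le> s powr P" using assms by (intro powr_mono) auto
  then show ?thesis using False by simp
qed

lemma powr_above_tangent:
  fixes P s u :: real
  assumes P: "P \<ge> 1" and s: "s \<ge> 0" and u: "u \<ge> 0"
  shows "u powr P + P * u powr (P - 1) * (s - u) \<le> s powr P"
proof (cases "u = 0 \<or> s = 0")
  \<comment> \<open>The boundary point 0 is treated by hand. Since \<open>0 powr 0 = 0\<close>, the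
    left side vanishes at \<open>u = 0\<close> even for \<open>P = 1\<close>.\<close>
  case True
  then show ?thesis
  proof
    assume "s = 0"
    have "u powr P = u powr (P - 1) * u" using u by (cases "u = 0") (auto simp: powr_mult_base mult.commute)
    then have "u powr P + P * u powr (P - 1) * (s - u) = (1 - P) * u powr P"
      using \<open>s = 0\<close> by (simp add: algebra_simps)
    also have "\<dots> \<le> 0" using P by (intro mult_nonpos_nonneg) auto
    finally show ?thesis using \<open>s = 0\<close> by simp
  qed simp
next
  case False
  then have "u > 0" "s > 0" using s u by auto
  have "P * u powr (P - 1) * (s - u) \<le> s powr P - u powr P"
    by (rule convex_on_imp_above_tangent[OF powr_convex[OF P]])
       (use \<open>u > 0\<close> \<open>s > 0\<close> in \<open>auto simp: interior_open intro!: derivative_eq_intros\<close>)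
  then show ?thesis by simp
qed

text \<open>Jensen's inequality for the measure with density \<open>k\<close> and total mass \<open>M\<close>:
  integrate the tangent line of \<open>s powr P\<close> at the mean value.\<close>
lemma powr_integral_le:
  fixes k g :: "real \<Rightarrow> real"
  assumes P: "P \<ge> 1" and k: "integrable lborel k" "\<And>t. k t \<ge> 0" and M: "(LINT t|lborel. k t) = M" "M > 0"
    and g: "\<And>t. g t \<ge> 0" and kg: "integrable lborel (\<lambda>t. k t * g t)" and kgP: "integrable lborel (\<lambda>t. k t * g t powr P)"
  shows "(LINT t|lborel. k t * g t) powr P \<le> M powr (P - 1) * (LINT t|lborel. k t * g t powr P)"
proof -
  define m where "m = (LINT t|lborel. k t * g t)"
  define u where "u = m / M"
  have m0: "m \<ge> 0" unfolding m_def using k g by (intro integral_nonneg_AE) auto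
  then have u0: "u \<ge> 0" using M by (simp add: u_def)
  define A B where "A = P * u powr (P - 1)" and "B = u powr P - A * u"
  have "(LINT t|lborel. A * (k t * g t) + B * k t) \<le> (LINT t|lborel. k t * g t powr P)"
  proof (rule integral_mono)
    show "A * (k t * g t) + B * k t \<le> k t * g t powr P" for t
      using mult_left_mono[OF powr_above_tangent[OF P g[of t] u0] k(2)[of t]]
      by (simp add: A_def B_def algebra_simps)
  qed (use kg k kgP in auto)
  also have "(LINT t|lborel. A * (k t * g t) + B * k t) = A * m + B * M"
    using kg k M by (simp add: m_def)
  also have "\<dots> = M * u powr P"
    using M by (simp add: B_def u_def algebra_simps)
  also have "\<dots> = M * (m powr P / M powr P)" using m0 M by (simp add: u_def powr_divide)
  finally have "M powr (P - 1) * (M * (m powr P / M powr P)) \<le> M powr (P - 1) * (LINT t|lborel. k t * g t powr P)"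
    by (intro mult_left_mono) auto
  also have "M powr (P - 1) * (M * (m powr P / M powr P)) = m powr P"
    using M(2) by (simp add: powr_diff)
  finally show ?thesis by (simp add: m_def)
qed

lemma locally_integrable_continuous:
  assumes "continuous_on UNIV (f :: real \<Rightarrow> real)"
  shows "locally_integrable f"
  unfolding locally_integrable_def
  using assms borel_integrable_compact[of "{_.._}" f] continuous_on_subset[OF assms]
  by (auto simp: set_integrable_def mult.commute)

lemma locally_integrable_powr:
  assumes f: "f \<in> borel_measurable lborel" and fP: "integrable lborel (\<lambda>x. \<bar>f x\<bar> powr P)" and P: "P \<ge> 1"
  shows "locally_integrable f"
  unfolding locally_integrable_def set_integrable_def
proof (intro allI)
  fix a b :: real
  show "integrable lborel (\<lambda>x. indicator {a..b} x *\<^sub>R f x)"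
  proof (rule Bochner_Integration.integrable_bound)
    show "integrable lborel (\<lambda>x. indicator {a..b} x + \<bar>f x\<bar> powr P)"
      using fP by (intro Bochner_Integration.integrable_add integrable_real_indicator) (auto simp: emeasure_lborel_Icc_eq)
    show "AE x in lborel. norm (indicator {a..b} x *\<^sub>R f x) \<le> norm (indicator {a..b} x + \<bar>f x\<bar> powr P)"
      using abs_le_one_plus_powr[OF abs_ge_zero P] by (intro AE_I2) (auto simp: indicator_def)
  qed (use f in auto)
qed

section \<open>Growth of the primitive, and the Green operator as a solution operator\<close>

lemma primitive_mono:
  assumes "\<And>x. 0 \<le> q x" "primitive_of q Q" "u \<le> v"
  shows "Q u \<le> Q v"
proof -
  have "0 \<le> (LINT t:{u..v}|lborel. q t)"
    unfolding set_lebesgue_integral_def using assms(1) by (intro Bochner_Integration.integral_nonneg) simp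
  then show ?thesis using primitive_ofD[OF assms(2,3)] by simp
qed

text \<open>Each step of length \<open>2 * a\<close> raises \<open>Q\<close> by at least \<delta>.
  Counting the whole steps between \<open>x\<close> and \<open>t\<close> gives the slope;
  monotonicity covers the incomplete last step, at the price of the term
  \<open>- \<delta>\<close>.\<close>

lemma primitive_linear_growth:
  assumes q: "\<And>x. 0 \<le> q x" and Q: "primitive_of q Q" and a: "a > 0" and d: "\<delta> > 0"
    and le: "\<And>x. \<delta> \<le> (LINT t:{x-a..x+a}|lborel. q t)" and xt: "x \<le> t"
  shows "\<delta> / (2 * a) * (t - x) - \<delta> \<le> Q t - Q x"
proof -
  have step: "\<delta> \<le> Q (z + 2 * a) - Q z" for z
    using le[of "z + a"] primitive_ofD[OF Q, of z "z + 2*a"] a by (simp add: algebra_simps)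
  have iter: "real n * \<delta> \<le> Q (x + real n * (2 * a)) - Q x" for n
  proof (induction n)
    case (Suc n)
    then show ?case using step[of "x + real n * (2*a)"] by (simp add: algebra_simps)
  qed simp
  define n where "n = nat \<lfloor>(t - x) / (2 * a)\<rfloor>"
  have n: "real n = of_int \<lfloor>(t - x) / (2 * a)\<rfloor>" using xt a by (simp add: n_def)
  have n1: "(t - x) / (2 * a) - 1 \<le> real n" unfolding n by linarith
  have "real n \<le> (t - x) / (2 * a)" unfolding n by linarith
  then have "x + real n * (2 * a) \<le> t" using a by (simp add: field_simps)
  then have "Q (x + real n * (2 * a)) \<le> Q t" by (rule primitive_mono[OF q Q])
  moreover have "\<delta> * ((t - x) / (2 * a) - 1) \<le> \<delta> * real n" using n1 d by (intro mult_left_mono) auto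
  ultimately show ?thesis using iter[of n] by (simp add: algebra_simps)
qed

lemma green_eq:
  assumes "primitive_of q Q"
  shows "green q x t = (if t < x then 0 else exp (Q x - Q t))"
  using primitive_ofD[OF assms, of x t] by (auto simp: green_def algebra_simps)

text \<open>The Green integral is the member \<open>c = 0\<close> of the solution family when
  \<open>H\<close> is minus the integral of \<open>exp (- Q) f\<close> over the half-line to the
  right of \<open>x\<close>.\<close>

lemma is_solution_green:
  assumes q: "locally_integrable q" and Q: "primitive_of q Q" and f: "locally_integrable f"
    and int: "\<And>x. integrable lborel (\<lambda>t. green q x t * f t)"
  shows "is_solution q f (\<lambda>x. LINT t|lborel. green q x t * f t)"
proof -
  define g where "g t = exp (- Q t) * f t" for t
  have g: "indicator {x..} t * g t = exp (- Q x) * (green q x t * f t)" for x t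
    by (auto simp: green_eq[OF Q] g_def indicator_def exp_diff exp_minus field_simps)
  have gi: "integrable lborel (\<lambda>t. indicator {x..} t * g t)" for x
    unfolding g using int by simp
  define H where "H x = - (LINT t|lborel. indicator {x..} t * g t)" for x
  have "primitive_of g H"
    unfolding primitive_of_def
  proof (intro allI impI)
    fix u v :: real assume uv: "u \<le> v"
    have "H v - H u = (LINT t|lborel. indicator {u..} t * g t - indicator {v..} t * g t)"
      unfolding H_def by (subst Bochner_Integration.integral_diff[OF gi gi]) simp
    also have "\<dots> = (LINT t|lborel. indicator {u..v} t * (indicator {u..} t * g t))"
    proof (rule integral_cong_AE)
      show "(\<lambda>t. indicator {u..} t * g t - indicator {v..} t * g t) \<in> borel_measurable lborel"
        by (rule borel_measurable_diff[OF borel_measurable_integrable[OF gi] borel_measurable_integrable[OF gi]])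
      show "(\<lambda>t. indicator {u..v} t * (indicator {u..} t * g t)) \<in> borel_measurable lborel"
        by (rule borel_measurable_times[OF _ borel_measurable_integrable[OF gi]]) auto
      \<comment> \<open>The two half-lines differ by an interval without its right endpoint
        \<open>v\<close>, hence the exceptional point.\<close>
      show "AE t in lborel. indicator {u..} t * g t - indicator {v..} t * g t = indicator {u..v} t * (indicator {u..} t * g t)"
        using AE_lborel_singleton[of v] by eventually_elim (use uv in \<open>auto simp: indicator_def\<close>)
    qed
    also have "\<dots> = (LINT t:{u..v}|lborel. g t)"
      unfolding set_lebesgue_integral_def by (rule Bochner_Integration.integral_cong) (auto simp: indicator_def)
    finally show "H v - H u = (LINT t:{u..v}|lborel. g t)" .
  qed
  then have H: "primitive_of (\<lambda>t. exp (- Q t) * f t) H" by (simp add: g_def[abs_def])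
  have "(LINT t|lborel. green q x t * f t) = exp (Q x) * (0 - H x)" for x
    unfolding H_def g by (simp add: exp_minus)
  then show ?thesis using is_solution_iff[OF q Q f H] by blast
qed

lemma enn2real_ge_one:
  assumes "1 \<le> p" "p \<noteq> (\<infinity>::ennreal)"
  shows "1 \<le> enn2real p"
  using enn2real_mono[of 1 p] assms by (simp add: top.not_eq_extremum)

lemma locally_integrable_in_Lp:
  assumes "1 \<le> p" "in_Lp p f"
  shows "locally_integrable f"
  using assms locally_integrable_continuous[of f] locally_integrable_powr[of f "enn2real p"]
    enn2real_ge_one[of p] by (auto simp: in_Lp_def split: if_splits)

text \<open>Exponential decay of \<open>exp (Q x - Q t)\<close> is isolated as the form in which the
  condition on \<open>q0\<close> enters the sufficiency proof. \<open>damped_if_q0_pos\<close>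
  provides it.\<close>

locale damped =
  fixes q Q :: "real \<Rightarrow> real" and C \<kappa> :: real
  assumes q_loc: "locally_integrable q" and q_nonneg: "\<And>x. 0 \<le> q x" and Q: "primitive_of q Q"
    and C_pos: "C > 0" and \<kappa>_pos: "\<kappa> > 0"
    and decay: "\<And>x t. x \<le> t \<Longrightarrow> exp (Q x - Q t) \<le> C * exp (- \<kappa> * (t - x))"
begin

definition ker :: "real \<Rightarrow> real" where
  "ker s = C * exp (- \<kappa> * s) * indicator {0..} s"

text \<open>The \<open>L_1\<close> norm of \<open>ker\<close>, and the constant in the norm estimate
  for every \<open>p\<close>.\<close>

definition mass :: real where "mass = C / \<kappa>"

lemma mass_pos: "mass > 0" using C_pos \<kappa>_pos by (simp add: mass_def)

lemma ker_nonneg: "ker s \<ge> 0" using C_pos by (simp add: ker_def)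

lemma ker_le: "ker s \<le> C"
  using C_pos \<kappa>_pos by (simp add: ker_def indicator_def)

lemma ker_measurable [measurable]: "ker \<in> borel_measurable borel"
  unfolding ker_def by measurable

lemma nn_integral_ker: "(\<integral>\<^sup>+s. ennreal (ker s) \<partial>lborel) = ennreal mass"
proof -
  have "(\<integral>\<^sup>+s. ennreal (ker s) \<partial>lborel) = (\<integral>\<^sup>+s. ennreal (C * exp (- \<kappa> * s)) * indicator {0..} s \<partial>lborel)"
    by (intro nn_integral_cong) (auto simp: ker_def indicator_def)
  also have "\<dots> = ennreal (0 - (- C / \<kappa> * exp (- \<kappa> * 0)))"
  proof (rule nn_integral_FTC_atLeast)
    show "((\<lambda>s. - C / \<kappa> * exp (- \<kappa> * s)) has_real_derivative C * exp (- \<kappa> * s)) (at s)" for s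
      by (rule derivative_eq_intros refl)+ (use \<kappa>_pos in simp)
    have "filterlim (\<lambda>s. - \<kappa> * s) at_bot at_top"
      using \<kappa>_pos by (intro filterlim_tendsto_neg_mult_at_bot[OF tendsto_const] filterlim_ident) auto
    then have "((\<lambda>s. exp (- \<kappa> * s)) \<longlongrightarrow> 0) at_top"
      by (rule filterlim_compose[OF exp_at_bot])
    then show "((\<lambda>s. - C / \<kappa> * exp (- \<kappa> * s)) \<longlongrightarrow> 0) at_top"
      by (rule tendsto_mult_right_zero)
  qed (use C_pos in auto)
  finally show ?thesis by (simp add: mass_def)
qed

lemma integrable_ker: "integrable lborel ker"
  by (rule integrableI_nonneg) (simp_all add: ker_nonneg nn_integral_ker)

lemma integral_ker: "(LINT s|lborel. ker s) = mass"
  using integral_eq_nn_integral[of ker lborel] nn_integral_ker mass_pos by (simp add: ker_nonneg)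

lemma integrable_ker_shift: "integrable lborel (\<lambda>t. ker (t - x))"
  using lborel_integrable_real_affine[OF integrable_ker, of 1 "-x"] by (simp add: algebra_simps)

lemma integral_ker_shift: "(LINT t|lborel. ker (t - x)) = mass"
  using lborel_integral_real_affine[of 1 ker "-x"] integral_ker by (simp add: algebra_simps)

text \<open>After the order of integration is swapped in \<open>nn_integral_convolution\<close>, the
  inner variable is the base point \<open>x\<close>, so the mass of the reflected kernel is what
  counts.\<close>

lemma nn_integral_ker_reflect: "(\<integral>\<^sup>+x. ennreal (ker (t - x)) \<partial>lborel) = ennreal mass"
  using nn_integral_real_affine[of "\<lambda>s. ennreal (ker s)" "-1" t] nn_integral_ker by simp

lemma Q_continuous: "continuous_on UNIV Q"
  by (rule abs_cont_imp_continuous[OF abs_cont_primitive[OF q_loc Q]])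

lemma Q_measurable [measurable]: "Q \<in> borel_measurable borel"
  by (rule borel_measurable_continuous_onI[OF Q_continuous])

lemma green_measurable [measurable]: "green q x \<in> borel_measurable borel"
proof -
  have "green q x = (\<lambda>t. if t < x then 0 else exp (Q x - Q t))" using green_eq[OF Q] by auto
  then show ?thesis by simp
qed

lemma abs_green_le: "\<bar>green q x t\<bar> \<le> ker (t - x)"
  using decay[of x t] C_pos by (auto simp: green_eq[OF Q] ker_def indicator_def)

lemma integrable_green_mult:
  assumes f: "f \<in> borel_measurable borel" and int: "integrable lborel (\<lambda>t. ker (t - x) * \<bar>f t\<bar>)"
  shows "integrable lborel (\<lambda>t. green q x t * f t)"
    and "\<bar>LINT t|lborel. green q x t * f t\<bar> \<le> (LINT t|lborel. ker (t - x) * \<bar>f t\<bar>)"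
proof -
  have le: "\<bar>green q x t * f t\<bar> \<le> ker (t - x) * \<bar>f t\<bar>" for t
    unfolding abs_mult by (intro mult_right_mono abs_green_le) simp
  show i: "integrable lborel (\<lambda>t. green q x t * f t)"
    by (rule Bochner_Integration.integrable_bound[OF int])
       (use f le in \<open>auto intro!: AE_I2 intro: order_trans[OF _ abs_ge_self]\<close>)
  have "\<bar>LINT t|lborel. green q x t * f t\<bar> \<le> (LINT t|lborel. \<bar>green q x t * f t\<bar>)" by (rule integral_abs_bound)
  also have "\<dots> \<le> (LINT t|lborel. ker (t - x) * \<bar>f t\<bar>)"
    by (rule integral_mono) (use i int le in auto)
  finally show "\<bar>LINT t|lborel. green q x t * f t\<bar> \<le> (LINT t|lborel. ker (t - x) * \<bar>f t\<bar>)" .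
qed

text \<open>The endpoint \<open>p = \<infinity>\<close> of Young's inequality.\<close>

lemma green_bounded:
  assumes f: "f \<in> borel_measurable borel" and B: "\<And>t. \<bar>f t\<bar> \<le> B"
  shows "integrable lborel (\<lambda>t. green q x t * f t)"
    and "\<bar>LINT t|lborel. green q x t * f t\<bar> \<le> mass * B"
proof -
  have le: "ker (t - x) * \<bar>f t\<bar> \<le> ker (t - x) * B" for t
    by (intro mult_left_mono B ker_nonneg)
  have intB: "integrable lborel (\<lambda>t. ker (t - x) * B)"
    by (intro integrable_mult_left integrable_ker_shift)
  have int: "integrable lborel (\<lambda>t. ker (t - x) * \<bar>f t\<bar>)"
  proof (rule Bochner_Integration.integrable_bound[OF intB])
    show "AE t in lborel. norm (ker (t - x) * \<bar>f t\<bar>) \<le> norm (ker (t - x) * B)"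
      using order_trans[OF le abs_ge_self] by (intro AE_I2) (simp add: abs_mult ker_nonneg)
  qed (use f in auto)
  show "integrable lborel (\<lambda>t. green q x t * f t)" by (rule integrable_green_mult(1)[OF f int])
  have "\<bar>LINT t|lborel. green q x t * f t\<bar> \<le> (LINT t|lborel. ker (t - x) * \<bar>f t\<bar>)"
    by (rule integrable_green_mult(2)[OF f int])
  also have "\<dots> \<le> (LINT t|lborel. ker (t - x) * B)"
    by (rule integral_mono[OF int intB le])
  also have "\<dots> = mass * B" by (simp add: integral_ker_shift)
  finally show "\<bar>LINT t|lborel. green q x t * f t\<bar> \<le> mass * B" .
qed

section \<open>Young's inequality for finite exponents\<close>

context
  fixes f :: "real \<Rightarrow> real" and P :: real
  assumes f [measurable]: "f \<in> borel_measurable borel" and fP: "integrable lborel (\<lambda>t. \<bar>f t\<bar> powr P)" and P: "P \<ge> 1"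
begin

lemma integrable_ker_powr: "integrable lborel (\<lambda>t. ker (t - x) * \<bar>f t\<bar> powr P)"
  by (rule Bochner_Integration.integrable_bound[OF integrable_mult_right[OF fP, of C]])
     (auto intro!: AE_I2 mult_right_mono simp: abs_mult ker_nonneg intro: order_trans[OF ker_le])

lemma integrable_ker_abs: "integrable lborel (\<lambda>t. ker (t - x) * \<bar>f t\<bar>)"
proof (rule Bochner_Integration.integrable_bound)
  show "integrable lborel (\<lambda>t. ker (t - x) + ker (t - x) * \<bar>f t\<bar> powr P)"
    by (intro Bochner_Integration.integrable_add integrable_ker_shift integrable_ker_powr)
  show "AE t in lborel. norm (ker (t - x) * \<bar>f t\<bar>) \<le> norm (ker (t - x) + ker (t - x) * \<bar>f t\<bar> powr P)"
  proof (rule AE_I2)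
    fix t
    have "ker (t - x) * \<bar>f t\<bar> \<le> ker (t - x) * (1 + \<bar>f t\<bar> powr P)"
      by (intro mult_left_mono abs_le_one_plus_powr P ker_nonneg) simp
    then show "norm (ker (t - x) * \<bar>f t\<bar>) \<le> norm (ker (t - x) + ker (t - x) * \<bar>f t\<bar> powr P)"
      by (simp add: abs_mult ker_nonneg algebra_simps)
  qed
qed measurable

lemma integrable_green_powr: "integrable lborel (\<lambda>t. green q x t * f t)"
  by (rule integrable_green_mult(1)[OF f integrable_ker_abs])

text \<open>Jensen's inequality for the weight \<open>ker (t - x)\<close>, whose mass does not
  depend on \<open>x\<close>. It reduces the \<open>L_P\<close> estimate to an \<open>L_1\<close>
  convolution of \<open>ker\<close> with the \<open>P\<close>-th power of \<open>f\<close>.\<close>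

lemma abs_green_powr_le:
  "\<bar>LINT t|lborel. green q x t * f t\<bar> powr P \<le> mass powr (P - 1) * (LINT t|lborel. ker (t - x) * \<bar>f t\<bar> powr P)"
proof -
  have "\<bar>LINT t|lborel. green q x t * f t\<bar> powr P \<le> (LINT t|lborel. ker (t - x) * \<bar>f t\<bar>) powr P"
    using P by (intro powr_mono2 integrable_green_mult(2) f integrable_ker_abs) auto
  also have "\<dots> \<le> mass powr (P - 1) * (LINT t|lborel. ker (t - x) * \<bar>f t\<bar> powr P)"
    by (rule powr_integral_le[OF P integrable_ker_shift ker_nonneg integral_ker_shift mass_pos
          abs_ge_zero integrable_ker_abs integrable_ker_powr])
  finally show ?thesis .
qed

text \<open>Tonelli's theorem: for fixed \<open>t\<close> the integral over \<open>x\<close>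
  contributes the factor \<open>mass\<close>. Nonnegative integrals permit the swap before
  integrability in \<open>x\<close> is known.\<close>

lemma nn_integral_convolution:
  "(\<integral>\<^sup>+x. ennreal (LINT t|lborel. ker (t - x) * \<bar>f t\<bar> powr P) \<partial>lborel)
     = ennreal (mass * (LINT t|lborel. \<bar>f t\<bar> powr P))"
proof -
  have "(\<integral>\<^sup>+x. ennreal (LINT t|lborel. ker (t - x) * \<bar>f t\<bar> powr P) \<partial>lborel)
      = (\<integral>\<^sup>+x. \<integral>\<^sup>+t. ennreal (ker (t - x) * \<bar>f t\<bar> powr P) \<partial>lborel \<partial>lborel)"
    by (intro nn_integral_cong nn_integral_eq_integral[symmetric] integrable_ker_powr) (simp add: ker_nonneg)
  also have "\<dots> = (\<integral>\<^sup>+t. \<integral>\<^sup>+x. ennreal (ker (t - x) * \<bar>f t\<bar> powr P) \<partial>lborel \<partial>lborel)"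
    by (rule lborel_pair.Fubini') measurable
  also have "\<dots> = (\<integral>\<^sup>+t. ennreal mass * ennreal (\<bar>f t\<bar> powr P) \<partial>lborel)"
  proof (rule nn_integral_cong)
    fix t
    have "(\<integral>\<^sup>+x. ennreal (ker (t - x) * \<bar>f t\<bar> powr P) \<partial>lborel)
        = (\<integral>\<^sup>+x. ennreal (ker (t - x)) * ennreal (\<bar>f t\<bar> powr P) \<partial>lborel)"
      by (simp add: ennreal_mult ker_nonneg)
    also have "\<dots> = ennreal mass * ennreal (\<bar>f t\<bar> powr P)"
      by (subst nn_integral_multc) (auto simp: nn_integral_ker_reflect)
    finally show "(\<integral>\<^sup>+x. ennreal (ker (t - x) * \<bar>f t\<bar> powr P) \<partial>lborel) = ennreal mass * ennreal (\<bar>f t\<bar> powr P)" .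
  qed
  also have "\<dots> = ennreal mass * (\<integral>\<^sup>+t. ennreal (\<bar>f t\<bar> powr P) \<partial>lborel)"
    by (rule nn_integral_cmult) measurable
  also have "(\<integral>\<^sup>+t. ennreal (\<bar>f t\<bar> powr P) \<partial>lborel) = ennreal (LINT t|lborel. \<bar>f t\<bar> powr P)"
    by (rule nn_integral_eq_integral[OF fP]) simp
  finally show ?thesis using mass_pos by (simp add: ennreal_mult)
qed

text \<open>The factor \<open>mass powr (P - 1)\<close> from Jensen and the factor
  \<open>mass\<close> from Tonelli combine to \<open>mass powr P\<close>, so the \<open>P\<close>-th
  root leaves \<open>mass\<close>. Measurability of \<open>y\<close> is a hypothesis here; it will
  come from the continuity of \<open>y\<close> as a solution.\<close>

lemma green_powr:
  defines "y \<equiv> \<lambda>x. LINT t|lborel. green q x t * f t"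
  assumes y: "y \<in> borel_measurable borel"
  shows "integrable lborel (\<lambda>x. \<bar>y x\<bar> powr P)"
    and "(LINT x|lborel. \<bar>y x\<bar> powr P) \<le> mass powr P * (LINT t|lborel. \<bar>f t\<bar> powr P)"
proof -
  have "(\<integral>\<^sup>+x. ennreal (\<bar>y x\<bar> powr P) \<partial>lborel)
      \<le> (\<integral>\<^sup>+x. ennreal (mass powr (P - 1)) * ennreal (LINT t|lborel. ker (t - x) * \<bar>f t\<bar> powr P) \<partial>lborel)"
    unfolding y_def using abs_green_powr_le
    by (intro nn_integral_mono) (simp add: ennreal_mult'[symmetric] ennreal_leI)
  also have "\<dots> = ennreal (mass powr (P - 1)) * (\<integral>\<^sup>+x. ennreal (LINT t|lborel. ker (t - x) * \<bar>f t\<bar> powr P) \<partial>lborel)"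
    by (rule nn_integral_cmult) measurable
  also have "\<dots> = ennreal (mass powr (P - 1) * (mass * (LINT t|lborel. \<bar>f t\<bar> powr P)))"
    by (simp add: nn_integral_convolution ennreal_mult')
  also have "mass powr (P - 1) * (mass * (LINT t|lborel. \<bar>f t\<bar> powr P)) = mass powr P * (LINT t|lborel. \<bar>f t\<bar> powr P)"
    using mass_pos by (simp add: powr_diff)
  finally have le: "(\<integral>\<^sup>+x. ennreal (\<bar>y x\<bar> powr P) \<partial>lborel) \<le> ennreal (mass powr P * (LINT t|lborel. \<bar>f t\<bar> powr P))" .
  show int: "integrable lborel (\<lambda>x. \<bar>y x\<bar> powr P)"
    by (rule integrableI_nonneg) (use y le in \<open>auto intro: order_le_less_trans\<close>)
  have "ennreal (LINT x|lborel. \<bar>y x\<bar> powr P) \<le> ennreal (mass powr P * (LINT t|lborel. \<bar>f t\<bar> powr P))"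
    using le nn_integral_eq_integral[OF int] by simp
  then show "(LINT x|lborel. \<bar>y x\<bar> powr P) \<le> mass powr P * (LINT t|lborel. \<bar>f t\<bar> powr P)"
    by (subst (asm) ennreal_le_iff) (auto intro!: mult_nonneg_nonneg integral_nonneg_AE)
qed

end

section \<open>Uniqueness of solutions in \<open>L_p\<close>\<close>

lemma exp_Q_ge: "t \<ge> 0 \<Longrightarrow> exp (Q t) \<ge> exp (Q 0) / C * (\<kappa> * t)"
proof -
  assume t: "t \<ge> 0"
  have "exp (Q 0) / C * (\<kappa> * t) \<le> exp (Q 0) / C * exp (\<kappa> * t)"
    using C_pos exp_ge_add_one_self[of "\<kappa> * t"] by (intro mult_left_mono) (linarith, simp)
  also have "\<dots> \<le> exp (Q t)"
    using decay[OF t] C_pos by (simp add: exp_diff exp_minus field_simps)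
  finally show ?thesis .
qed

text \<open>Bounding the multiple of \<open>exp Q\<close> by
  \<open>\<bar>y1\<bar> + \<bar>y2\<bar>\<close> bypasses closure of \<open>L_p\<close> under
  differences. On the positive half-line \<open>exp Q\<close> is unbounded, which settles
  \<open>p = \<infinity>\<close>, and stays above \<open>exp (Q 0)\<close> on a set of infinite
  measure, which settles finite \<open>p\<close>.\<close>

lemma exp_Q_multiple_not_in_Lp:
  assumes p: "1 \<le> p" and y: "in_Lp p y1" "in_Lp p y2" and d: "\<And>x. y1 x - y2 x = c * exp (Q x)"
  shows "c = 0"
proof (rule ccontr)
  assume c: "c \<noteq> 0"
  have le: "\<bar>c\<bar> * exp (Q x) \<le> \<bar>y1 x\<bar> + \<bar>y2 x\<bar>" for x
    using d[of x] by (metis abs_exp_cancel abs_mult abs_triangle_ineq4)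
  show False
  proof (cases "p = \<infinity>")
    case True
    then have "bounded (range y1)" "bounded (range y2)" using y by (auto simp: in_Lp_def)
    then obtain B1 B2 where "\<And>x. \<bar>y1 x\<bar> \<le> B1" "\<And>x. \<bar>y2 x\<bar> \<le> B2"
      unfolding bounded_iff by auto
    then have B: "\<bar>c\<bar> * exp (Q x) \<le> B1 + B2" for x using le[of x] by (meson add_mono order_trans)
    define a where "a = \<bar>c\<bar> * (exp (Q 0) / C * \<kappa>)"
    have a: "a > 0" using c C_pos \<kappa>_pos by (simp add: a_def)
    have B0: "B1 + B2 \<ge> 0" using B[of 0] by (meson abs_ge_zero exp_ge_zero mult_nonneg_nonneg order_trans)
    \<comment> \<open>Chosen so that the linear lower bound \<open>a * t\<close> exceeds
      \<open>B1 + B2\<close> by exactly 1.\<close>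
    define t where "t = (B1 + B2 + 1) / a"
    have "t \<ge> 0" using a B0 by (simp add: t_def)
    have "a * t \<le> \<bar>c\<bar> * exp (Q t)"
      using mult_left_mono[OF exp_Q_ge[OF \<open>t \<ge> 0\<close>], of "\<bar>c\<bar>"] by (simp add: a_def algebra_simps)
    also have "\<dots> \<le> B1 + B2" by (rule B)
    finally show False using a by (simp add: t_def)
  next
    case False
    define P where "P = enn2real p"
    have P: "P \<ge> 1" using enn2real_ge_one[OF p False] by (simp add: P_def)
    have int: "integrable lborel (\<lambda>x. \<bar>y1 x\<bar> powr P + \<bar>y2 x\<bar> powr P)"
      using y False by (intro Bochner_Integration.integrable_add) (auto simp: in_Lp_def P_def)
    \<comment> \<open>Half of the lower bound for \<open>\<bar>y1\<bar> + \<bar>y2\<bar>\<close>: at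
      each \<open>x \<ge> 0\<close> at least one of the two reaches \<open>b\<close>.\<close>
    define b where "b = \<bar>c\<bar> * exp (Q 0) / 2"
    have b: "b > 0" using c by (simp add: b_def)
    have lb: "b powr P \<le> \<bar>y1 x\<bar> powr P + \<bar>y2 x\<bar> powr P" if "x \<ge> 0" for x
    proof -
      have "\<bar>c\<bar> * exp (Q 0) \<le> \<bar>c\<bar> * exp (Q x)"
        using primitive_mono[OF q_nonneg Q that] by (intro mult_left_mono) auto
      then have "b \<le> \<bar>y1 x\<bar> \<or> b \<le> \<bar>y2 x\<bar>" using le[of x] unfolding b_def by linarith
      then show ?thesis
      proof
        assume "b \<le> \<bar>y1 x\<bar>"
        then have "b powr P \<le> \<bar>y1 x\<bar> powr P" using b P by (intro powr_mono2) auto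
        then show ?thesis using powr_ge_zero[of "\<bar>y2 x\<bar>" P] by linarith
      next
        assume "b \<le> \<bar>y2 x\<bar>"
        then have "b powr P \<le> \<bar>y2 x\<bar> powr P" using b P by (intro powr_mono2) auto
        then show ?thesis using powr_ge_zero[of "\<bar>y1 x\<bar>" P] by linarith
      qed
    qed
    have "real n * b powr P \<le> (LINT x|lborel. \<bar>y1 x\<bar> powr P + \<bar>y2 x\<bar> powr P)" for n :: nat
    proof -
      have "real n * b powr P = (LINT x|lborel. b powr P * indicator {0..real n} x)" by simp
      also have "\<dots> \<le> (LINT x|lborel. \<bar>y1 x\<bar> powr P + \<bar>y2 x\<bar> powr P)"
      proof (rule integral_mono[OF _ int])
        show "integrable lborel (\<lambda>x. b powr P * indicator {0..real n} x)"
          by (intro integrable_mult_right integrable_real_indicator) auto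
        show "b powr P * indicator {0..real n} x \<le> \<bar>y1 x\<bar> powr P + \<bar>y2 x\<bar> powr P" for x
          using lb[of x] by (auto simp: indicator_def)
      qed
      finally show ?thesis .
    qed
    moreover obtain n :: nat where "(LINT x|lborel. \<bar>y1 x\<bar> powr P + \<bar>y2 x\<bar> powr P) < real n * b powr P"
      using reals_Archimedean3[of "b powr P"] b by auto
    ultimately show False by (meson not_less)
  qed
qed

lemma solution_unique:
  assumes p: "1 \<le> p" and f: "locally_integrable f"
    and y: "in_Lp p y1" "in_Lp p y2" "is_solution q f y1" "is_solution q f y2"
  shows "y1 = y2"
proof -
  have "continuous_on UNIV (\<lambda>t. exp (- Q t))" using Q_continuous by (intro continuous_intros)
  then have "locally_integrable (\<lambda>t. exp (- Q t) * f t)" using f by (rule locally_integrable_continuous_mult)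
  then obtain H where H: "primitive_of (\<lambda>t. exp (- Q t) * f t) H" by (rule primitive_exists)
  obtain c1 c2 where c: "\<And>x. y1 x = exp (Q x) * (c1 - H x)" "\<And>x. y2 x = exp (Q x) * (c2 - H x)"
    using y(3,4) is_solution_iff[OF q_loc Q f H] by blast
  have "c1 - c2 = 0"
    by (rule exp_Q_multiple_not_in_Lp[OF p y(1,2)]) (simp add: c algebra_simps)
  then show ?thesis using c by auto
qed

section \<open>Existence, norm bound and Green representation\<close>

lemma green_in_Lp:
  assumes p: "1 \<le> p" and f: "in_Lp p f"
  defines "y \<equiv> \<lambda>x. LINT t|lborel. green q x t * f t"
  shows "integrable lborel (\<lambda>t. green q x t * f t)" and "is_solution q f y" and "in_Lp p y"
    and "Lp_norm p y \<le> mass * Lp_norm p f"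
proof -
  have fl: "locally_integrable f" by (rule locally_integrable_in_Lp[OF p f])
  have int: "integrable lborel (\<lambda>t. green q x t * f t)" for x
  proof (cases "p = \<infinity>")
    case True
    then have "continuous_on UNIV f" "bounded (range f)" using f by (auto simp: in_Lp_def)
    then obtain B where "\<And>t. \<bar>f t\<bar> \<le> B" unfolding bounded_iff by auto
    then show ?thesis using \<open>continuous_on UNIV f\<close> by (intro green_bounded(1) borel_measurable_continuous_onI)
  next
    case False
    then show ?thesis using f enn2real_ge_one[OF p False]
      by (intro integrable_green_powr[of f "enn2real p"]) (auto simp: in_Lp_def)
  qed
  then show "integrable lborel (\<lambda>t. green q x t * f t)" .
  show sol: "is_solution q f y" unfolding y_def by (rule is_solution_green[OF q_loc Q fl int])
  \<comment> \<open>Continuity serves twice: it is part of membership for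
    \<open>p = \<infinity>\<close>, and it yields measurability for finite \<open>p\<close>.\<close>
  then have yc: "continuous_on UNIV y" by (intro abs_cont_imp_continuous) (simp add: is_solution_def)
  have "in_Lp p y \<and> Lp_norm p y \<le> mass * Lp_norm p f"
  proof (cases "p = \<infinity>")
    case True
    then have fc: "continuous_on UNIV f" "bounded (range f)" using f by (auto simp: in_Lp_def)
    then obtain B where "\<And>t. \<bar>f t\<bar> \<le> B" unfolding bounded_iff by auto
    then have "bdd_above (range (\<lambda>x. \<bar>f x\<bar>))" by (intro bdd_aboveI2[of _ _ B])
    then have "\<bar>f t\<bar> \<le> (SUP x. \<bar>f x\<bar>)" for t by (intro cSUP_upper) auto
    then have le: "\<bar>y x\<bar> \<le> mass * (SUP x. \<bar>f x\<bar>)" for x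
      unfolding y_def using fc by (intro green_bounded(2) borel_measurable_continuous_onI)
    then have "bounded (range y)" unfolding bounded_iff by auto
    moreover have "(SUP x. \<bar>y x\<bar>) \<le> mass * (SUP x. \<bar>f x\<bar>)" using le by (intro cSUP_least) auto
    ultimately show ?thesis using True yc by (simp add: in_Lp_def Lp_norm_def)
  next
    case False
    define P where "P = enn2real p"
    have P: "P \<ge> 1" using enn2real_ge_one[OF p False] by (simp add: P_def)
    have fm: "f \<in> borel_measurable borel" "integrable lborel (\<lambda>x. \<bar>f x\<bar> powr P)"
      using f False by (auto simp: in_Lp_def P_def)
    have ym: "y \<in> borel_measurable borel" by (rule borel_measurable_continuous_onI[OF yc])
    have gp: "integrable lborel (\<lambda>x. \<bar>y x\<bar> powr P)"
      "(LINT x|lborel. \<bar>y x\<bar> powr P) \<le> mass powr P * (LINT t|lborel. \<bar>f t\<bar> powr P)"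
      using green_powr[OF fm P] ym unfolding y_def by blast+
    have "(LINT x|lborel. \<bar>y x\<bar> powr P) powr (1 / P) \<le> (mass powr P * (LINT t|lborel. \<bar>f t\<bar> powr P)) powr (1 / P)"
      using P by (intro powr_mono2 gp(2) integral_nonneg_AE) auto
    also have "\<dots> = mass * (LINT t|lborel. \<bar>f t\<bar> powr P) powr (1 / P)"
      using P mass_pos by (simp add: powr_mult powr_powr integral_nonneg_AE)
    finally show ?thesis using False ym gp(1) by (simp add: in_Lp_def Lp_norm_def P_def)
  qed
  then show "in_Lp p y" "Lp_norm p y \<le> mass * Lp_norm p f" by auto
qed

lemma solution_eq_green:
  assumes p: "1 \<le> p" and f: "in_Lp p f" and y: "in_Lp p y" "is_solution q f y"
  shows "y = (\<lambda>x. LINT t|lborel. green q x t * f t)"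
  by (rule solution_unique[OF p locally_integrable_in_Lp[OF p f] y(1) green_in_Lp(3)[OF p f] y(2) green_in_Lp(2)[OF p f]])

lemma correctly_solvable:
  assumes p: "1 \<le> p"
  shows "correctly_solvable q p"
  unfolding correctly_solvable_def
proof (intro conjI allI impI exI[of _ mass] mass_pos)
  fix f assume f: "in_Lp p f"
  show "\<exists>!y. in_Lp p y \<and> is_solution q f y"
  proof (rule ex1I)
    show "in_Lp p (\<lambda>x. LINT t|lborel. green q x t * f t) \<and> is_solution q f (\<lambda>x. LINT t|lborel. green q x t * f t)"
      using green_in_Lp(2,3)[OF p f] by simp
  qed (use solution_eq_green[OF p f] in auto)
next
  fix f y assume f: "in_Lp p f" and y: "in_Lp p y" "is_solution q f y"
  show "Lp_norm p y \<le> mass * Lp_norm p f"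
    unfolding solution_eq_green[OF p f y] by (rule green_in_Lp(4)[OF p f])
qed

end

subsection \<open>Necessity of the condition\<close>

lemma primitive_of_continuous:
  assumes c: "continuous_on UNIV h" and d: "\<And>x. (H has_real_derivative h x) (at x)"
  shows "primitive_of h H"
  unfolding primitive_of_def
proof (intro allI impI)
  fix u v :: real assume uv: "u \<le> v"
  have "isCont h x" for x using c by (simp add: continuous_on_eq_continuous_at)
  then have "has_bochner_integral lborel (\<lambda>x. h x * indicator {u..v} x) (H v - H u)"
    using uv d by (intro has_bochner_integral_FTC_Icc_real) auto
  then show "H v - H u = (LINT t:{u..v}|lborel. h t)"
    unfolding set_lebesgue_integral_def by (simp add: has_bochner_integral_integral_eq mult.commute)
qed

text \<open>The \<open>L_p\<close> norm of the indicator function of an interval of length \<open>L\<close>.\<close>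
definition interval_norm :: "ennreal \<Rightarrow> real \<Rightarrow> real" where
  "interval_norm p L = (if p = \<infinity> then 1 else L powr (1 / enn2real p))"

lemma interval_norm_pos: "L > 0 \<Longrightarrow> interval_norm p L > 0"
  by (simp add: interval_norm_def)

text \<open>The test datum lives on an interval of length \<open>2 * a\<close>, while the solution
  is bounded below on one of length \<open>a\<close>. The factor \<open>2 powr (1 / p)\<close>
  between the two norms is at most 2 for every \<open>p\<close>.\<close>

lemma interval_norm_double:
  assumes "1 \<le> p" "L > 0"
  shows "interval_norm p (2 * L) \<le> 2 * interval_norm p L"
proof (cases "p = \<infinity>")
  case False
  have "2 powr (1 / enn2real p) \<le> (2::real) powr 1"
    using enn2real_ge_one[OF assms(1) False] by (intro powr_mono) auto
  then show ?thesis using False assms by (simp add: interval_norm_def powr_mult mult_right_mono)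
qed (simp add: interval_norm_def)

lemma Lp_supported_on_interval:
  assumes p: "1 \<le> p" and g: "continuous_on UNIV g" and m: "m \<ge> 0" and lu: "l \<le> u"
    and le: "\<And>t. \<bar>g t\<bar> \<le> m * indicator {l..u} t"
  shows "in_Lp p g" and "Lp_norm p g \<le> m * interval_norm p (u - l)"
proof -
  have "in_Lp p g \<and> Lp_norm p g \<le> m * interval_norm p (u - l)"
  proof (cases "p = \<infinity>")
    case True
    have gm: "\<bar>g t\<bar> \<le> m" for t using le[of t] m by (cases "t \<in> {l..u}") auto
    then have "bounded (range g)" unfolding bounded_iff by auto
    moreover have "(SUP x. \<bar>g x\<bar>) \<le> m" using gm by (intro cSUP_least) auto
    ultimately show ?thesis using True g by (simp add: in_Lp_def Lp_norm_def interval_norm_def)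
  next
    case False
    define P where "P = enn2real p"
    have P: "P \<ge> 1" using enn2real_ge_one[OF p False] by (simp add: P_def)
    have gb: "g \<in> borel_measurable borel" by (rule borel_measurable_continuous_onI[OF g])
    have b: "\<bar>g t\<bar> powr P \<le> m powr P * indicator {l..u} t" for t
      using le[of t] powr_mono2[of P "\<bar>g t\<bar>" m] P by (auto simp: indicator_def split: if_splits)
    have i0: "integrable lborel (\<lambda>t. m powr P * indicator {l..u} t)"
      by (intro integrable_mult_right integrable_real_indicator) (auto simp: emeasure_lborel_Icc_eq)
    have i: "integrable lborel (\<lambda>t. \<bar>g t\<bar> powr P)"
    proof (rule Bochner_Integration.integrable_bound[OF i0])
      show "AE t in lborel. norm (\<bar>g t\<bar> powr P) \<le> norm (m powr P * indicator {l..u} t)"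
        using order_trans[OF b abs_ge_self] by (intro AE_I2) simp
    qed (use gb in measurable)
    have "(LINT t|lborel. \<bar>g t\<bar> powr P) \<le> (LINT t|lborel. m powr P * indicator {l..u} t)"
      by (rule integral_mono[OF i i0 b])
    also have "\<dots> = m powr P * (u - l)" using lu by simp
    finally have "(LINT t|lborel. \<bar>g t\<bar> powr P) powr (1 / P) \<le> (m powr P * (u - l)) powr (1 / P)"
      using P by (intro powr_mono2 integral_nonneg_AE) auto
    also have "\<dots> = m * (u - l) powr (1 / P)"
      using P m lu by (simp add: powr_mult powr_powr)
    finally show ?thesis using False gb i by (simp add: in_Lp_def Lp_norm_def interval_norm_def P_def)
  qed
  then show "in_Lp p g" "Lp_norm p g \<le> m * interval_norm p (u - l)" by auto
qed

lemma Lp_norm_ge_on_interval: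
  assumes p: "1 \<le> p" and g: "in_Lp p g" and m: "m \<ge> 0" and lu: "l \<le> u"
    and ge: "\<And>t. t \<in> {l..u} \<Longrightarrow> m \<le> \<bar>g t\<bar>"
  shows "m * interval_norm p (u - l) \<le> Lp_norm p g"
proof (cases "p = \<infinity>")
  case True
  then have "bounded (range g)" using g by (simp add: in_Lp_def)
  then obtain B where "\<And>t. \<bar>g t\<bar> \<le> B" unfolding bounded_iff by auto
  then have "bdd_above (range (\<lambda>x. \<bar>g x\<bar>))" by (intro bdd_aboveI2[of _ _ B])
  then have "\<bar>g l\<bar> \<le> (SUP x. \<bar>g x\<bar>)" by (intro cSUP_upper) auto
  then show ?thesis using ge[of l] lu True by (simp add: Lp_norm_def interval_norm_def)
next
  case False
  define P where "P = enn2real p"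
  have P: "P \<ge> 1" using enn2real_ge_one[OF p False] by (simp add: P_def)
  have i: "integrable lborel (\<lambda>t. \<bar>g t\<bar> powr P)" using g False by (simp add: in_Lp_def P_def)
  have "m powr P * (u - l) = (LINT t|lborel. m powr P * indicator {l..u} t)" using lu by simp
  also have "\<dots> \<le> (LINT t|lborel. \<bar>g t\<bar> powr P)"
  proof (rule integral_mono[OF _ i])
    show "integrable lborel (\<lambda>t. m powr P * indicator {l..u} t)"
      by (intro integrable_mult_right integrable_real_indicator) (auto simp: emeasure_lborel_Icc_eq)
    show "m powr P * indicator {l..u} t \<le> \<bar>g t\<bar> powr P" for t
      using powr_mono2[of P m "\<bar>g t\<bar>"] ge[of t] m P by (auto simp: indicator_def)
  qed
  finally have "(m powr P * (u - l)) powr (1 / P) \<le> (LINT t|lborel. \<bar>g t\<bar> powr P) powr (1 / P)"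
    using P lu by (intro powr_mono2) auto
  also have "(m powr P * (u - l)) powr (1 / P) = m * (u - l) powr (1 / P)"
    using P m lu by (simp add: powr_mult powr_powr)
  finally show ?thesis using False by (simp add: Lp_norm_def interval_norm_def P_def)
qed

text \<open>The reason for the outer square in the bump: the kink of the positive part disappears,
  so \<phi> is continuously differentiable and the datum \<open>f\<close> is continuous.\<close>

lemma has_derivative_positive_part_square:
  "((\<lambda>z::real. (max 0 z)\<^sup>2) has_real_derivative 2 * max 0 z) (at z)"
proof -
  consider "z > 0" | "z < 0" | "z = 0" by linarith
  then show ?thesis
  proof cases
    case 1
    have "((\<lambda>z::real. z\<^sup>2) has_real_derivative 2 * max 0 z) (at z)"
      using 1 by (auto intro!: derivative_eq_intros)
    then show ?thesis
      by (rule has_field_derivative_transform_within_open[of _ _ _ "{0<..}"]) (use 1 in auto)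
  next
    case 2
    have "((\<lambda>z::real. 0) has_real_derivative 2 * max 0 z) (at z)" using 2 by auto
    then show ?thesis
      by (rule has_field_derivative_transform_within_open[of _ _ _ "{..<0}"]) (use 2 in auto)
  next
    case 3
    have "((\<lambda>h::real. (max 0 h)\<^sup>2 / h) \<longlongrightarrow> 0) (at 0)"
    proof (rule Lim_null_comparison)
      show "\<forall>\<^sub>F h in at 0. norm ((max 0 h)\<^sup>2 / h) \<le> \<bar>h::real\<bar>"
        by (intro always_eventually allI) (auto simp: max_def power2_eq_square)
      show "((\<lambda>h::real. \<bar>h\<bar>) \<longlongrightarrow> 0) (at 0)" by (intro tendsto_rabs_zero tendsto_ident_at)
    qed
    then show ?thesis using 3 by (simp add: DERIV_def)
  qed
qed

text \<open>If \<open>q\<close> has integral less than 1 over a long interval around \<open>x\<close>, the solution \<open>y = \<phi> exp (Q - Q x)\<close>, with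
  the bump \<open>\<phi> t = (max 0 (1 - ((t - x) / a)\<^sup>2))\<^sup>2\<close>, has size of order 1 while \<open>f = - \<phi>' exp (Q - Q x)\<close>
  has size of order \<open>1 / a\<close>.\<close>
lemma slow_decay_test_function:
  assumes q: "locally_integrable q" "\<And>x. 0 \<le> q x" and p: "1 \<le> p" and a: "a > 0"
    and x: "(LINT t:{x-a..x+a}|lborel. q t) < 1"
  obtains f y where "in_Lp p f" "in_Lp p y" "is_solution q f y"
    "Lp_norm p f \<le> 12 / a * interval_norm p (2 * a)" "1 / 6 * interval_norm p a \<le> Lp_norm p y"
proof -
  obtain Q where Q: "primitive_of q Q" using primitive_exists[OF q(1)] by blast
  have Qc: "continuous_on UNIV Q" by (rule abs_cont_imp_continuous[OF abs_cont_primitive[OF q(1) Q]])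
  define s where "s t = (t - x) / a" for t
  define w where "w t = max 0 (1 - (s t)\<^sup>2)" for t
  define \<phi> where "\<phi> t = (w t)\<^sup>2" for t
  \<comment> \<open>The chain rule: \<open>2 * w t\<close> times the inner derivative
    \<open>- 2 * s t / a\<close>; where the parabola is cut off, \<open>w\<close> vanishes.\<close>
  define \<phi>' where "\<phi>' t = - (4 / a) * s t * w t" for t
  have sd: "(s has_real_derivative 1 / a) (at t)" for t
    unfolding s_def using a by (auto intro!: derivative_eq_intros)
  have \<phi>d: "(\<phi> has_real_derivative \<phi>' t) (at t)" for t
  proof -
    have "((\<lambda>t. 1 - (s t)\<^sup>2) has_real_derivative - 2 * s t / a) (at t)"
      by (auto intro!: derivative_eq_intros sd)
    from DERIV_chain2[OF has_derivative_positive_part_square this]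
    show ?thesis unfolding \<phi>_def w_def \<phi>'_def by (simp add: algebra_simps)
  qed
  have c: "continuous_on UNIV s" "continuous_on UNIV w" "continuous_on UNIV \<phi>" "continuous_on UNIV \<phi>'"
    unfolding \<phi>_def \<phi>'_def w_def s_def by (intro continuous_intros; use a in simp)+
  have inside: "\<bar>s t\<bar> \<le> 1" if "t \<in> {x-a..x+a}" for t using that a by (auto simp: s_def abs_le_iff field_simps)
  have outside: "w t = 0" if "t \<notin> {x-a..x+a}" for t
  proof -
    have "1 \<le> \<bar>s t\<bar>" using that a by (auto simp: s_def field_simps abs_if)
    then have "1 \<le> (s t)\<^sup>2" using abs_le_square_iff[of 1 "s t"] by simp
    then show ?thesis by (simp add: w_def)
  qed
  have w: "0 \<le> w t" "w t \<le> 1" for t by (auto simp: w_def)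
  define E where "E t = exp (Q t - Q x)" for t
  \<comment> \<open>The integral of \<open>q\<close> over the interval is below 1, so
    \<open>Q t\<close> and \<open>Q x\<close> differ by at most 1; 3 is a rounded value of Euler's
    number.\<close>
  have E: "1 / 3 \<le> E t" "E t \<le> 3" if t: "t \<in> {x-a..x+a}" for t
  proof -
    have "Q (x - a) \<le> Q t" "Q t \<le> Q (x + a)" "Q (x - a) \<le> Q x" "Q x \<le> Q (x + a)"
      using t a by (auto intro: primitive_mono[OF q(2) Q])
    moreover have "Q (x + a) - Q (x - a) < 1" using primitive_ofD[OF Q, of "x-a" "x+a"] x a by simp
    ultimately have b: "Q t - Q x \<le> 1" "Q x - Q t \<le> 1" by linarith+
    have "exp (Q t - Q x) \<le> exp 1" "exp (Q x - Q t) \<le> exp 1" using b by auto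
    then have "exp (Q t - Q x) \<le> 3" "exp (Q x - Q t) \<le> 3" using exp_le by linarith+
    then show "1 / 3 \<le> E t" "E t \<le> 3" unfolding E_def by (auto simp: exp_diff field_simps)
  qed
  have Ec: "continuous_on UNIV E" unfolding E_def using Qc by (intro continuous_intros)
  define y where "y t = \<phi> t * E t" for t
  define f where "f t = - \<phi>' t * E t" for t
  have fc: "continuous_on UNIV f" and yc: "continuous_on UNIV y"
    unfolding f_def y_def using c Ec by (auto intro!: continuous_intros)
  \<comment> \<open>The factor \<open>exp (Q t)\<close> cancels against the integrating factor, so
    the primitive is the bump itself up to a constant, and \<open>y\<close> is the solution with
    \<open>c = 0\<close>.\<close>
  define H where "H t = - \<phi> t * exp (- Q x)" for t
  have "primitive_of (\<lambda>t. - \<phi>' t * exp (- Q x)) H"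
  proof (rule primitive_of_continuous)
    show "continuous_on UNIV (\<lambda>t. - \<phi>' t * exp (- Q x))" using c by (intro continuous_intros)
    show "(H has_real_derivative - \<phi>' t * exp (- Q x)) (at t)" for t
      unfolding H_def by (rule derivative_eq_intros \<phi>d refl)+ simp
  qed
  moreover have "(\<lambda>t. exp (- Q t) * f t) = (\<lambda>t. - \<phi>' t * exp (- Q x))"
    by (auto simp: f_def E_def exp_diff exp_minus field_simps)
  ultimately have H: "primitive_of (\<lambda>t. exp (- Q t) * f t) H" by simp
  have sol: "is_solution q f y"
    unfolding is_solution_iff[OF q(1) Q locally_integrable_continuous[OF fc] H]
    by (intro exI[of _ 0]) (auto simp: y_def H_def E_def exp_diff exp_minus field_simps)
  \<comment> \<open>\<open>12 / a\<close> is \<open>4 / a\<close> from \<open>\<phi>'\<close> times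
    the bound 3 for \<open>E\<close>.\<close>
  have fb: "\<bar>f t\<bar> \<le> 12 / a * indicator {x-a..x+a} t" for t
  proof (cases "t \<in> {x-a..x+a}")
    case True
    have "\<bar>f t\<bar> = 4 / a * (\<bar>s t\<bar> * w t * E t)" using a w by (simp add: f_def \<phi>'_def abs_mult E_def)
    also have "\<dots> \<le> 4 / a * (1 * 1 * 3)"
      using a w[of t] E[OF True] inside[OF True] by (intro mult_left_mono mult_mono) auto
    finally show ?thesis using True by simp
  next
    case False
    then show ?thesis using outside[OF False] by (simp add: f_def \<phi>'_def)
  qed
  have yb: "\<bar>y t\<bar> \<le> 3 * indicator {x-a..x+a} t" for t
  proof (cases "t \<in> {x-a..x+a}")
    case True
    have "\<bar>y t\<bar> = (w t)\<^sup>2 * E t" by (simp add: y_def \<phi>_def abs_mult E_def)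
    also have "\<dots> \<le> 1 * 3"
      using w[of t] E[OF True] by (intro mult_mono power_le_one) auto
    finally show ?thesis using True by simp
  next
    case False
    then show ?thesis using outside[OF False] by (simp add: y_def \<phi>_def)
  qed
  have f_Lp: "in_Lp p f" "Lp_norm p f \<le> 12 / a * interval_norm p ((x + a) - (x - a))"
    using a by (intro Lp_supported_on_interval[OF p fc _ _ fb]; simp)+
  have y_Lp: "in_Lp p y"
    using a by (intro Lp_supported_on_interval[OF p yc _ _ yb]; simp)
  \<comment> \<open>On the middle half \<open>\<bar>s t\<bar> \<le> 1 / 2\<close>, so
    \<open>\<phi> t \<ge> 9 / 16 \<ge> 1 / 2\<close>; with \<open>E t \<ge> 1 / 3\<close> this gives
    \<open>1 / 6\<close>.\<close>
  have "1 / 6 * interval_norm p ((x + a / 2) - (x - a / 2)) \<le> Lp_norm p y"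
  proof (rule Lp_norm_ge_on_interval[OF p y_Lp])
    fix t assume t: "t \<in> {x - a / 2..x + a / 2}"
    then have "s t \<le> 1 / 2" "- (1 / 2) \<le> s t" using a by (simp_all add: s_def field_simps)
    then have "\<bar>s t\<bar> \<le> 1 / 2" by linarith
    then have "(s t)\<^sup>2 \<le> (1 / 2)\<^sup>2" using abs_le_square_iff[of "s t" "1/2"] by simp
    then have "3 / 4 \<le> w t" by (simp add: w_def power2_eq_square)
    then have "(3 / 4)\<^sup>2 \<le> (w t)\<^sup>2" by (intro power_mono) auto
    then have "1 / 2 \<le> \<phi> t" by (simp add: \<phi>_def power2_eq_square)
    moreover have "1 / 3 \<le> E t" using t a by (intro E) auto
    ultimately have "1 / 2 * (1 / 3) \<le> \<phi> t * E t" by (intro mult_mono) auto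
    then show "1 / 6 \<le> \<bar>y t\<bar>" by (simp add: y_def)
  qed (use a in auto)
  then show ?thesis using f_Lp y_Lp sol by (intro that[of f y]) auto
qed

lemma q0_pos_if_norm_bound:
  assumes q: "locally_integrable q" "\<And>x. 0 \<le> q x" and p: "1 \<le> p" and c: "c > 0"
    and bound: "\<And>f y. in_Lp p f \<Longrightarrow> in_Lp p y \<Longrightarrow> is_solution q f y \<Longrightarrow> Lp_norm p y \<le> c * Lp_norm p f"
  shows "\<exists>a>0. q0 q a > 0"
proof (rule ccontr)
  assume "\<not> (\<exists>a>0. q0 q a > 0)"
  \<comment> \<open>A contradiction requires \<open>24 * c / a < 1 / 6\<close>, that is
    \<open>a > 144 * c\<close>.\<close>
  define a where "a = 200 * c"
  have a: "a > 0" using c by (simp add: a_def)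
  then have "q0 q a < 1" using \<open>\<not> (\<exists>a>0. q0 q a > 0)\<close> by force
  then obtain x where "(LINT t:{x-a..x+a}|lborel. q t) < 1"
    unfolding q0_def using cInf_lessD[of "range (\<lambda>x. LINT t:{x-a..x+a}|lborel. q t)" 1] by blast
  then obtain f y where fy: "in_Lp p f" "in_Lp p y" "is_solution q f y"
    "Lp_norm p f \<le> 12 / a * interval_norm p (2 * a)" "1 / 6 * interval_norm p a \<le> Lp_norm p y"
    using slow_decay_test_function[OF q p a] by blast
  note fy(5)
  also have "Lp_norm p y \<le> c * Lp_norm p f" by (rule bound[OF fy(1-3)])
  also have "\<dots> \<le> c * (12 / a * interval_norm p (2 * a))" using fy(4) c by (intro mult_left_mono) auto
  also have "\<dots> \<le> c * (12 / a * (2 * interval_norm p a))"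
    using interval_norm_double[OF p a] c a by (intro mult_left_mono) auto
  also have "\<dots> = 24 / 200 * interval_norm p a" using c by (simp add: a_def)
  finally show False using interval_norm_pos[OF a, of p] by simp
qed

text \<open>Exponentiating the linear growth of \<open>Q\<close> gives the rate
  \<open>\<delta> / (2 * a)\<close>, and the loss from the incomplete step becomes the constant
  \<open>exp \<delta>\<close>.\<close>

lemma damped_if_q0_pos:
  assumes q: "locally_integrable q" "\<And>x. 0 \<le> q x" and a: "a > 0" "q0 q a > 0"
  obtains Q C \<kappa> where "damped q Q C \<kappa>"
proof -
  obtain Q where Q: "primitive_of q Q" using primitive_exists[OF q(1)] by blast
  define \<delta> where "\<delta> = q0 q a"
  \<comment> \<open>An infimum of reals bounds its family from below only if the family is bounded
    below; here 0 is a bound because \<open>q\<close> is nonnegative.\<close>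
  have "bdd_below (range (\<lambda>x. LINT t:{x-a..x+a}|lborel. q t))"
    unfolding set_lebesgue_integral_def
    by (intro bdd_belowI2[of _ 0] Bochner_Integration.integral_nonneg) (simp add: q(2))
  then have le: "\<delta> \<le> (LINT t:{x-a..x+a}|lborel. q t)" for x
    unfolding \<delta>_def q0_def by (intro cINF_lower) auto
  have "damped q Q (exp \<delta>) (\<delta> / (2 * a))"
  proof
    fix x t :: real assume xt: "x \<le> t"
    have "\<delta> / (2 * a) * (t - x) - \<delta> \<le> Q t - Q x"
      using primitive_linear_growth[OF q(2) Q a(1) _ le xt] a by (simp add: \<delta>_def)
    then have "exp (Q x - Q t) \<le> exp (\<delta> + - (\<delta> / (2 * a)) * (t - x))" by simp
    then show "exp (Q x - Q t) \<le> exp \<delta> * exp (- (\<delta> / (2 * a)) * (t - x))" by (simp only: exp_add)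
  qed (use q Q a in \<open>auto simp: \<delta>_def\<close>)
  then show ?thesis by (rule that)
qed

theorem theorem1p3:
  fixes q :: "real \<Rightarrow> real"
  assumes q_meas: "q \<in> borel_measurable lborel"
    and q_nonneg: "\<And>x. 0 \<le> q x"
    and q_loc: "\<And>a b. set_integrable lborel {a..b} q"
  shows "(\<forall>p::ennreal. 1 \<le> p \<longrightarrow> (correctly_solvable q p \<longleftrightarrow> (\<exists>a>0. q0 q a > 0)))
    \<and> (((\<forall>p::ennreal. 1 \<le> p \<longrightarrow> correctly_solvable q p)
          \<or> (\<forall>p::ennreal. 1 \<le> p \<longrightarrow> \<not> correctly_solvable q p))
       \<and> \<not> ((\<forall>p::ennreal. 1 \<le> p \<longrightarrow> correctly_solvable q p)
          \<and> (\<forall>p::ennreal. 1 \<le> p \<longrightarrow> \<not> correctly_solvable q p)))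
    \<and> (\<forall>p::ennreal. 1 \<le> p \<longrightarrow> correctly_solvable q p \<longrightarrow>
         (\<forall>f y. in_Lp p f \<longrightarrow> in_Lp p y \<longrightarrow> is_solution q f y \<longrightarrow>
            (\<forall>x. integrable lborel (\<lambda>t. green q x t * f t) \<and>
                 y x = (LINT t|lborel. green q x t * f t))))"
proof -
  have q: "locally_integrable q" using q_loc by (simp add: locally_integrable_def)
  have nec: "\<exists>a>0. q0 q a > 0" if "1 \<le> p" "correctly_solvable q p" for p
  proof -
    from that(2) obtain c where "c > 0"
      "\<And>f y. in_Lp p f \<Longrightarrow> in_Lp p y \<Longrightarrow> is_solution q f y \<Longrightarrow> Lp_norm p y \<le> c * Lp_norm p f"
      unfolding correctly_solvable_def by blast
    then show ?thesis by (rule q0_pos_if_norm_bound[OF q q_nonneg that(1)])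
  qed
  have suf: "correctly_solvable q p" if "1 \<le> p" "\<exists>a>0. q0 q a > 0" for p
    using that damped_if_q0_pos[OF q q_nonneg] damped.correctly_solvable by metis
  have rep: "integrable lborel (\<lambda>t. green q x t * f t) \<and> y x = (LINT t|lborel. green q x t * f t)"
    if p: "1 \<le> p" "correctly_solvable q p" and fy: "in_Lp p f" "in_Lp p y" "is_solution q f y" for p f y x
  proof -
    obtain Q C \<kappa> where d: "damped q Q C \<kappa>"
      using nec[OF p] damped_if_q0_pos[OF q q_nonneg] by metis
    show ?thesis
      using damped.green_in_Lp(1)[OF d p(1) fy(1)] damped.solution_eq_green[OF d p(1) fy] by metis
  qed
  \<comment> \<open>One admissible exponent is exhibited: without it both alternatives would hold
    vacuously, so this is what makes them exclusive.\<close>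
  have one: "1 \<le> (1::ennreal)" by simp
  show ?thesis
    using nec suf rep one by meson
qed

end
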